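(* Let $\alpha,\beta,\gamma,\delta,\epsilon,\phi$ be smooth real functions of $(x,y)$ on an open region, and consider the third order ordinary differential equation for $y=y(x)$ $$y'''-\alpha y'^5+\beta y'^4-\gamma y'^3+\delta y'^2-\epsilon y'+\phi=0. \qquad (\ast)$$ Suppose that the functions $c,g,h,d$ of $(x,y)$ are given by $$c=\frac{\sqrt{\alpha}}{\sqrt 3},\qquad g=\frac{\beta-c_y}{5c},\qquad h=\frac{\gamma-2g^2-g_y+c_x}{4c},\qquad d=\frac{\delta-3gh-h_y+g_x}{3c},$$ with $c\neq 0$, and that the consistency conditions $$\epsilon=2dg+h^2+d_y-h_x,\qquad \phi=dh-d_x$$ hold. If there are functions $a,b,e,f$ of $(x,y)$ with $h=a-2e$ and $g=f-2b$ such that the linearizability criteria $$3b_x+2g_x+h_y+3be-3cd=0,\qquad b_y-c_x+b^2+bg+ch+ce=0,$$ $$d_y-e_x-bd-dg-e^2-eh=0,\qquad 3e_y+2h_y+g_x+3be-3cd=0$$ are satisfied, then equation $(\ast)$ is linearizable.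
   Context: Subscripts $x,y$ denote partial derivatives; primes denote derivatives with respect to $x$; functions are smooth and all statements are local. The equations considered are obtained by differentiating the cubically semi-linear second order equation $$y''+c\,y'^3-g\,y'^2+h\,y'-d=0, \qquad (\ast\ast)$$ with $c,g,h,d$ functions of $(x,y)$. This equation is the projection (elimination of the geodetic parameter) of the quadratically semi-linear system $$x''=a x'^2+2b x'y'+c y'^2,\qquad y''=d x'^2+2e x'y'+f y'^2,$$ in which primes temporarily denote differentiation with respect to the parameter and $a,\dots,f$ are functions of $(x,y)$, with $h=a-2e$, $g=f-2b$. Differentiating $(\ast\ast)$ with respect to $x$ and using $(\ast\ast)$ to eliminate $y''$ gives a third order equation that is quintic in $y'$. "Linearizable" for the third order equation $(\ast)$ means: $(\ast)$ is the equation obtained from $(\ast\ast)$ by differentiating it with respect to $x$ and then using $(\ast\ast)$ to eliminate $y''$ (so every solution of $(\ast\ast)$ is a solution of $(\ast)$), and the second order equation $(\ast\ast)$ is transformable to a linear second order equation by a locally invertible point transformation $u=u(x,y)$, $v=v(x,y)$. In particular only two, not necessarily three, arbitrary constants are guaranteed in the resulting solutions of $(\ast)$. *)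

theory Defs
  imports "HOL-Analysis.Analysis"
begin

section \<open>Smooth functions on open sets\<close>

definition pd_x :: "(real \<Rightarrow> real \<Rightarrow> real) \<Rightarrow> real \<Rightarrow> real \<Rightarrow> real" where
  "pd_x F x y = deriv (\<lambda>t. F t y) x"

definition pd_y :: "(real \<Rightarrow> real \<Rightarrow> real) \<Rightarrow> real \<Rightarrow> real \<Rightarrow> real" where
  "pd_y F x y = deriv (\<lambda>t. F x t) y"

text \<open>Both predicates below are meant for open sets, where the values of the function
  on the set determine its derivatives there.\<close>

fun Ck_on :: "nat \<Rightarrow> (real \<times> real) set \<Rightarrow> (real \<Rightarrow> real \<Rightarrow> real) \<Rightarrow> bool" where
  "Ck_on 0 D F \<longleftrightarrow> continuous_on D (\<lambda>(x, y). F x y)"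
| "Ck_on (Suc k) D F \<longleftrightarrow>
     (\<forall>(x, y)\<in>D. (\<lambda>t. F t y) differentiable (at x) \<and> (\<lambda>t. F x t) differentiable (at y)) \<and>
     Ck_on k D (pd_x F) \<and> Ck_on k D (pd_y F)"

definition smooth2_on :: "(real \<times> real) set \<Rightarrow> (real \<Rightarrow> real \<Rightarrow> real) \<Rightarrow> bool" where
  "smooth2_on D F \<longleftrightarrow> (\<forall>k. Ck_on k D F)"

definition smooth1_on :: "real set \<Rightarrow> (real \<Rightarrow> real) \<Rightarrow> bool" where
  "smooth1_on S f \<longleftrightarrow> (\<forall>k. \<forall>t\<in>S. (deriv ^^ k) f differentiable (at t))"

section \<open>Ordinary differential equations in jet coordinates\<close>

text \<open>An equation for \<open>y = y(x)\<close> is given by its left-hand side, a function of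
  \<open>x\<close>, \<open>y\<close> and the jet coordinates \<open>p = y'\<close>, \<open>q = y''\<close>, \<open>r = y'''\<close>.
  The functions \<open>total_deriv0\<close>, \<open>total_deriv1\<close>, \<open>total_deriv2\<close> are the total derivative
  \<open>d/dx\<close> along \<open>y(x)\<close> of functions of \<open>(x, y)\<close>, \<open>(x, y, p)\<close> and \<open>(x, y, p, q)\<close>.\<close>

definition total_deriv0 :: "(real \<Rightarrow> real \<Rightarrow> real) \<Rightarrow> real \<Rightarrow> real \<Rightarrow> real \<Rightarrow> real" where
  "total_deriv0 F x y p = deriv (\<lambda>t. F t y) x + p * deriv (\<lambda>t. F x t) y"

definition total_deriv1 ::
    "(real \<Rightarrow> real \<Rightarrow> real \<Rightarrow> real) \<Rightarrow> real \<Rightarrow> real \<Rightarrow> real \<Rightarrow> real \<Rightarrow> real" where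
  "total_deriv1 F x y p q =
     deriv (\<lambda>t. F t y p) x + p * deriv (\<lambda>t. F x t p) y + q * deriv (\<lambda>t. F x y t) p"

definition total_deriv2 ::
    "(real \<Rightarrow> real \<Rightarrow> real \<Rightarrow> real \<Rightarrow> real) \<Rightarrow> real \<Rightarrow> real \<Rightarrow> real \<Rightarrow> real \<Rightarrow> real \<Rightarrow> real" where
  "total_deriv2 F x y p q r =
     deriv (\<lambda>t. F t y p q) x + p * deriv (\<lambda>t. F x t p q) y
       + q * deriv (\<lambda>t. F x y t q) p + r * deriv (\<lambda>t. F x y p t) q"

definition cubic_ode2 ::
    "(real \<Rightarrow> real \<Rightarrow> real) \<Rightarrow> (real \<Rightarrow> real \<Rightarrow> real) \<Rightarrow> (real \<Rightarrow> real \<Rightarrow> real) \<Rightarrow>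
     (real \<Rightarrow> real \<Rightarrow> real) \<Rightarrow> real \<Rightarrow> real \<Rightarrow> real \<Rightarrow> real \<Rightarrow> real" where
  "cubic_ode2 c g h d x y p q = q + c x y * p ^ 3 - g x y * p ^ 2 + h x y * p - d x y"

definition quintic_ode3 ::
    "(real \<Rightarrow> real \<Rightarrow> real) \<Rightarrow> (real \<Rightarrow> real \<Rightarrow> real) \<Rightarrow> (real \<Rightarrow> real \<Rightarrow> real) \<Rightarrow>
     (real \<Rightarrow> real \<Rightarrow> real) \<Rightarrow> (real \<Rightarrow> real \<Rightarrow> real) \<Rightarrow> (real \<Rightarrow> real \<Rightarrow> real) \<Rightarrow>
     real \<Rightarrow> real \<Rightarrow> real \<Rightarrow> real \<Rightarrow> real" where
  "quintic_ode3 \<alpha> \<beta> \<gamma> \<delta> \<epsilon> \<phi> x y p r =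
     r - \<alpha> x y * p ^ 5 + \<beta> x y * p ^ 4 - \<gamma> x y * p ^ 3 + \<delta> x y * p ^ 2 - \<epsilon> x y * p + \<phi> x y"

text \<open>\<open>E3 = 0\<close>, with left-hand side free of \<open>q\<close>, arises by differentiating \<open>E2 = 0\<close>
  with respect to \<open>x\<close> and eliminating \<open>q\<close> by means of \<open>E2 = 0\<close>.\<close>

definition obtained_by_differentiating ::
    "(real \<times> real) set \<Rightarrow> (real \<Rightarrow> real \<Rightarrow> real \<Rightarrow> real \<Rightarrow> real) \<Rightarrow>
     (real \<Rightarrow> real \<Rightarrow> real \<Rightarrow> real \<Rightarrow> real) \<Rightarrow> bool" where
  "obtained_by_differentiating D E3 E2 \<longleftrightarrow>
     (\<forall>(x, y)\<in>D. \<forall>p q r. E2 x y p q = 0 \<longrightarrow> E3 x y p r = total_deriv2 E2 x y p q r)"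

section \<open>Point transformations and linearizability\<close>

definition invertible_point_transformation ::
    "(real \<times> real) set \<Rightarrow> (real \<Rightarrow> real \<Rightarrow> real) \<Rightarrow> (real \<Rightarrow> real \<Rightarrow> real) \<Rightarrow> bool" where
  "invertible_point_transformation U u v \<longleftrightarrow>
     smooth2_on U u \<and> smooth2_on U v \<and>
     inj_on (\<lambda>(x, y). (u x y, v x y)) U \<and>
     (\<forall>(x, y)\<in>U. pd_x u x y * pd_y v x y - pd_y u x y * pd_x v x y \<noteq> 0)"

text \<open>Prolongation to derivatives: \<open>dv/du\<close> and \<open>d\<^sup>2v/du\<^sup>2\<close> along the image of a curve
  \<open>y = y(x)\<close>, meaningful where the image is transversal to the lines \<open>u = const\<close>, that is,
  where \<open>total_deriv0 u x y p \<noteq> 0\<close>.\<close>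

definition prolong1 ::
    "(real \<Rightarrow> real \<Rightarrow> real) \<Rightarrow> (real \<Rightarrow> real \<Rightarrow> real) \<Rightarrow> real \<Rightarrow> real \<Rightarrow> real \<Rightarrow> real" where
  "prolong1 u v x y p = total_deriv0 v x y p / total_deriv0 u x y p"

definition prolong2 ::
    "(real \<Rightarrow> real \<Rightarrow> real) \<Rightarrow> (real \<Rightarrow> real \<Rightarrow> real) \<Rightarrow> real \<Rightarrow> real \<Rightarrow> real \<Rightarrow> real \<Rightarrow> real" where
  "prolong2 u v x y p q = total_deriv1 (prolong1 u v) x y p q / total_deriv0 u x y p"

definition linear_ode2 ::
    "(real \<Rightarrow> real) \<Rightarrow> (real \<Rightarrow> real) \<Rightarrow> (real \<Rightarrow> real) \<Rightarrow> real \<Rightarrow> real \<Rightarrow> real \<Rightarrow> real \<Rightarrow> real" where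
  "linear_ode2 k1 k0 m s w w1 w2 = w2 + k1 s * w1 + k0 s * w + m s"

definition transformable_to_linear ::
    "(real \<times> real) set \<Rightarrow> (real \<Rightarrow> real \<Rightarrow> real \<Rightarrow> real \<Rightarrow> real) \<Rightarrow> bool" where
  "transformable_to_linear D E2 \<longleftrightarrow>
     (\<forall>z\<in>D. \<exists>U u v k1 k0 m.
        open U \<and> z \<in> U \<and> U \<subseteq> D \<and> invertible_point_transformation U u v \<and>
        smooth1_on ((\<lambda>(x, y). u x y) ` U) k1 \<and>
        smooth1_on ((\<lambda>(x, y). u x y) ` U) k0 \<and>
        smooth1_on ((\<lambda>(x, y). u x y) ` U) m \<and>
        (\<forall>(x, y)\<in>U. \<forall>p q. total_deriv0 u x y p \<noteq> 0 \<longrightarrow>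
           (E2 x y p q = 0 \<longleftrightarrow>
            linear_ode2 k1 k0 m (u x y) (v x y) (prolong1 u v x y p) (prolong2 u v x y p q) = 0)))"

text \<open>The third order equation \<open>E3 = 0\<close> is linearizable by way of the cubically semi-linear
  second order equation with coefficients \<open>c\<close>, \<open>g\<close>, \<open>h\<close>, \<open>d\<close>.\<close>

definition linearizable_via ::
    "(real \<times> real) set \<Rightarrow> (real \<Rightarrow> real \<Rightarrow> real \<Rightarrow> real \<Rightarrow> real) \<Rightarrow>
     (real \<Rightarrow> real \<Rightarrow> real) \<Rightarrow> (real \<Rightarrow> real \<Rightarrow> real) \<Rightarrow> (real \<Rightarrow> real \<Rightarrow> real) \<Rightarrow>
     (real \<Rightarrow> real \<Rightarrow> real) \<Rightarrow> bool" where
  "linearizable_via D E3 c g h d \<longleftrightarrow>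
     smooth2_on D c \<and> smooth2_on D g \<and> smooth2_on D h \<and> smooth2_on D d \<and>
     obtained_by_differentiating D E3 (cubic_ode2 c g h d) \<and>
     transformable_to_linear D (cubic_ode2 c g h d)"

end

theory Submission
  imports Defs
begin

text \<open>The functions \<open>a, ..., f\<close> are, up to sign, the Christoffel symbols of a torsion-free connection whose
  unparametrized geodesics are the solutions of \<open>y'' + c y'\<^sup>3 - g y'\<^sup>2 + h y' - d = 0\<close>, and the
  linearizability criteria say that it is flat. Hence it has two independent affine functions \<open>u, v\<close>,
  solutions of \<open>u\<^sub>x\<^sub>x = - (a u\<^sub>x + d u\<^sub>y)\<close>, \<open>u\<^sub>x\<^sub>y = - (b u\<^sub>x + e u\<^sub>y)\<close>, \<open>u\<^sub>y\<^sub>y = - (c u\<^sub>x + f u\<^sub>y)\<close>,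
  and in the coordinates \<open>(u, v)\<close> the equation becomes \<open>d\<^sup>2v/du\<^sup>2 = 0\<close>. The affine functions come from
  the Frobenius theorem for linear total systems \<open>w\<^sub>x = A w\<close>, \<open>w\<^sub>y = B w\<close>.\<close>

subsection \<open>Closure properties of smooth functions\<close>

text \<open>Two obstacles shape the proof. First, \<open>Ck_on (Suc k)\<close> speaks of derivatives
  along slices and of the smoothness of these derivatives, not of joint continuity of the function
  itself, so joint differentiability has to be recovered before products or the inverse function
  argument can be treated. Second, a total system is solved line by line: along
  \<open>y = y0\<close>, then along each vertical line through it. Off the initial line nothing is
  known at first about the dependence on \<open>x\<close>, and yet the equation in \<open>x\<close>
  has to hold there. A direct estimate of the first order Taylor error in \<open>x\<close> yields
  differentiability and the value of the derivative together; it replaces any theory of smooth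
  dependence on initial values. Smoothness of the solution comes last, by bootstrapping. The
  condition \<open>K * r \<le> 1 / 2\<close> serves twice: it makes the Picard map a contraction and
  closes the growth estimates. The third order equation enters only by comparing the coefficients of
  the powers of \<open>p\<close>.\<close>

lemma eventually_slice:
  fixes D :: "('a::topological_space \<times> 'b::topological_space) set"
  assumes "open D" "(x, y) \<in> D"
  shows "\<forall>\<^sub>F t in nhds x. (t, y) \<in> D" and "\<forall>\<^sub>F t in nhds y. (x, t) \<in> D"
proof -
  have "open ((\<lambda>t. (t, y)) -` D)" "open (Pair x -` D)"
    using assms by (auto intro!: open_vimage continuous_intros)
  then show "\<forall>\<^sub>F t in nhds x. (t, y) \<in> D" "\<forall>\<^sub>F t in nhds y. (x, t) \<in> D"
    using assms by (auto simp: eventually_nhds)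
qed

lemma
  assumes "open D" "(x, y) \<in> D" "\<forall>(x, y)\<in>D. F x y = G x y"
  shows pd_x_cong: "pd_x F x y = pd_x G x y" and pd_y_cong: "pd_y F x y = pd_y G x y"
  unfolding pd_x_def pd_y_def using eventually_slice[OF assms(1,2)] assms(3)
  by (auto intro!: deriv_cong_ev elim!: eventually_mono)

lemma
  assumes "open D" "(x, y) \<in> D" "\<forall>(x, y)\<in>D. F x y = G x y"
  shows has_field_derivative_slice_x:
      "((\<lambda>t. F t y) has_field_derivative l) (at x) \<longleftrightarrow> ((\<lambda>t. G t y) has_field_derivative l) (at x)"
    and has_field_derivative_slice_y:
      "((\<lambda>t. F x t) has_field_derivative l) (at y) \<longleftrightarrow> ((\<lambda>t. G x t) has_field_derivative l) (at y)"
  using eventually_slice[OF assms(1,2)] assms(3)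
  by (intro DERIV_cong_ev refl; auto elim!: eventually_mono)+

text \<open>The coefficients of the second order equation are given by formulas valid on
  \<open>D\<close> only. Openness makes the slices agree near each point, so \<open>deriv\<close>
  agrees as well and the induction can pass to the partial derivatives.\<close>

lemma Ck_on_cong:
  assumes "open D" "\<forall>(x, y)\<in>D. F x y = G x y"
  shows "Ck_on k D F \<longleftrightarrow> Ck_on k D G"
  using assms(2)
proof (induction k arbitrary: F G)
  case 0
  then show ?case by (auto intro!: continuous_on_cong)
next
  case (Suc k)
  have "Ck_on k D (pd_x F) = Ck_on k D (pd_x G)" "Ck_on k D (pd_y F) = Ck_on k D (pd_y G)"
    by (intro Suc.IH; use pd_x_cong[OF assms(1) _ Suc.prems] pd_y_cong[OF assms(1) _ Suc.prems] in blast)+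
  then show ?case
    using has_field_derivative_slice_x[OF assms(1) _ Suc.prems]
      has_field_derivative_slice_y[OF assms(1) _ Suc.prems]
    by (fastforce simp: real_differentiable_def)
qed

lemma smooth2_on_cong:
  assumes "open D" "\<forall>(x, y)\<in>D. F x y = G x y"
  shows "smooth2_on D F \<longleftrightarrow> smooth2_on D G"
  unfolding smooth2_on_def using Ck_on_cong[OF assms] by blast

lemma Ck_on_subset: "Ck_on k D F \<Longrightarrow> U \<subseteq> D \<Longrightarrow> Ck_on k U F"
  by (induction k arbitrary: F) (auto intro: continuous_on_subset)

lemma smooth2_on_subset: "smooth2_on D F \<Longrightarrow> U \<subseteq> D \<Longrightarrow> smooth2_on U F"
  unfolding smooth2_on_def using Ck_on_subset by blast

lemma
  assumes "Ck_on (Suc k) D F" "(x, y) \<in> D"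
  shows Ck_on_has_pd_x: "((\<lambda>t. F t y) has_field_derivative pd_x F x y) (at x)"
    and Ck_on_has_pd_y: "((\<lambda>t. F x t) has_field_derivative pd_y F x y) (at y)"
  using assms by (auto simp: pd_x_def pd_y_def DERIV_deriv_iff_real_differentiable)

text \<open>The form used in every induction below: an explicit formula for the derivative takes the
  place of \<open>deriv\<close>, and the induction hypothesis is applied to that formula.\<close>

lemma Ck_on_SucI:
  assumes "open D" "Ck_on k D X" "Ck_on k D Y"
    and X: "\<And>x y. (x, y) \<in> D \<Longrightarrow> ((\<lambda>t. F t y) has_field_derivative X x y) (at x)"
    and Y: "\<And>x y. (x, y) \<in> D \<Longrightarrow> ((\<lambda>t. F x t) has_field_derivative Y x y) (at y)"
  shows "Ck_on (Suc k) D F"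
proof -
  have "Ck_on k D (pd_x F) = Ck_on k D X" "Ck_on k D (pd_y F) = Ck_on k D Y"
    using X Y by (auto intro!: Ck_on_cong[OF assms(1)] DERIV_imp_deriv simp: pd_x_def pd_y_def)
  moreover have "(\<lambda>t. F t y) differentiable at x" "(\<lambda>t. F x t) differentiable at y" if "(x, y) \<in> D" for x y
    using X[OF that] Y[OF that] real_differentiable_def by blast+
  ultimately show ?thesis
    using assms(2,3) by auto
qed

text \<open>Differentiability in \<open>x\<close> at the point and a continuous \<open>y\<close>
  derivative around it already give the joint derivative.\<close>

lemma C1_has_derivative:
  assumes "open D" "Ck_on (Suc 0) D F" "(x, y) \<in> D"
  shows "((\<lambda>(x, y). F x y) has_derivative (\<lambda>(s, t). pd_x F x y * s + pd_y F x y * t)) (at (x, y))"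
proof -
  obtain X Y where XY: "open X" "open Y" "x \<in> X" "y \<in> Y" "X \<times> Y \<subseteq> D"
    using open_prod_elim[OF assms(1,3)] by (metis mem_Times_iff fst_conv snd_conv)
  obtain e where e: "e > 0" "ball y e \<subseteq> Y"
    using XY openE by blast
  have sub: "X \<times> ball y e \<subseteq> D" using XY e by auto
  have y: "y \<in> ball y e" using e by simp
  have fx: "((\<lambda>x. F x y) has_derivative (*) (pd_x F x y)) (at x within X)"
    using Ck_on_has_pd_x[OF assms(2,3)] by (auto simp: has_field_derivative_def intro: has_derivative_at_withinI)
  have fy: "((\<lambda>t. F x' t) has_derivative blinfun_apply (blinfun_mult_right (pd_y F x' y'))) (at y' within ball y e)"
    if "x' \<in> X" "y' \<in> ball y e" for x' y'
  proof -
    have "(x', y') \<in> D" using that sub by blast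
    then show ?thesis
      using Ck_on_has_pd_y[OF assms(2)]
      by (simp add: has_field_derivative_def has_derivative_at_withinI blinfun_mult_right.rep_eq)
  qed
  have "continuous_on (X \<times> ball y e) (\<lambda>(x, y). pd_y F x y)"
    using assms(2) sub by (auto intro: continuous_on_subset)
  \<comment> \<open>The rule for partial derivatives asks for continuity of the \<open>y\<close>
    derivative as a bounded linear map, so the number \<open>pd_y F x y\<close> is read as
    multiplication by it.\<close>
  then have "continuous_on (X \<times> ball y e) (\<lambda>z. blinfun_mult_right (case z of (x, y) \<Rightarrow> pd_y F x y))"
    by (intro bounded_linear.continuous_on[OF bounded_linear_blinfun_mult_right])
  then have cont: "continuous (at (x, y) within X \<times> ball y e) (\<lambda>(x, y). blinfun_mult_right (pd_y F x y))"
    using XY y by (auto simp: continuous_on_eq_continuous_within case_prod_unfold)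
  have "((\<lambda>(x, y). F x y) has_derivative
      (\<lambda>(s, t). pd_x F x y * s + blinfun_apply (blinfun_mult_right (pd_y F x y)) t)) (at (x, y) within X \<times> ball y e)"
    by (rule has_derivative_partialsI[OF fx fy cont y convex_ball])
  moreover have "open (X \<times> ball y e)" "(x, y) \<in> X \<times> ball y e"
    using XY y by (auto intro: open_Times)
  ultimately show ?thesis
    by (simp only: at_within_open blinfun_mult_right.rep_eq)
qed

text \<open>The recursion for \<open>Ck_on\<close> does not contain this inclusion. Its base case,
  continuity of a function with continuous partial derivatives, follows from joint
  differentiability.\<close>

lemma Ck_on_SucD: "open D \<Longrightarrow> Ck_on (Suc k) D F \<Longrightarrow> Ck_on k D F"
proof (induction k arbitrary: F)
  case 0
  then have "continuous_on D (\<lambda>(x, y). F x y)"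
    by (intro continuous_at_imp_continuous_on ballI)
      (metis surj_pair C1_has_derivative has_derivative_continuous)
  then show ?case by simp
next
  case (Suc k)
  have "Ck_on k D (pd_x F)" "Ck_on k D (pd_y F)"
    by (rule Suc.IH[OF Suc.prems(1)]; use Suc.prems(2) in simp)+
  then show ?case
    using Suc.prems(2) by simp
qed

section \<open>Arithmetic, inverses and square roots of smooth functions\<close>

lemma Ck_on_const: "Ck_on k D (\<lambda>x y. l)"
proof (induction k arbitrary: l)
  case (Suc k)
  have "pd_x (\<lambda>x y. l) = (\<lambda>x y. 0)" "pd_y (\<lambda>x y. l) = (\<lambda>x y. 0)"
    by (simp_all add: pd_x_def[abs_def] pd_y_def[abs_def])
  then show ?case
    using Suc[of 0] by simp
qed simp

lemma Ck_on_add: "open D \<Longrightarrow> Ck_on k D F \<Longrightarrow> Ck_on k D G \<Longrightarrow> Ck_on k D (\<lambda>x y. F x y + G x y)"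
proof (induction k arbitrary: F G)
  case 0
  then show ?case by (auto simp: case_prod_unfold intro: continuous_on_add continuous_on_mult)
next
  case (Suc k)
  have "Ck_on k D (\<lambda>x y. pd_x F x y + pd_x G x y)" "Ck_on k D (\<lambda>x y. pd_y F x y + pd_y G x y)"
    using Suc by auto
  then show ?case
    by (rule Ck_on_SucI[OF Suc.prems(1)])
      (auto intro!: DERIV_add Ck_on_has_pd_x[OF Suc.prems(2)] Ck_on_has_pd_x[OF Suc.prems(3)]
         Ck_on_has_pd_y[OF Suc.prems(2)] Ck_on_has_pd_y[OF Suc.prems(3)])
qed

lemma Ck_on_mult: "open D \<Longrightarrow> Ck_on k D F \<Longrightarrow> Ck_on k D G \<Longrightarrow> Ck_on k D (\<lambda>x y. F x y * G x y)"
proof (induction k arbitrary: F G)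
  case 0
  then show ?case by (auto simp: case_prod_unfold intro: continuous_on_add continuous_on_mult)
next
  case (Suc k)
  \<comment> \<open>The product rule multiplies derivatives by the undifferentiated factors, which
    must therefore be known at the lower order too.\<close>
  have "Ck_on k D F" "Ck_on k D G"
    using Suc.prems Ck_on_SucD by blast+
  then have "Ck_on k D (\<lambda>x y. pd_x F x y * G x y + pd_x G x y * F x y)"
    "Ck_on k D (\<lambda>x y. pd_y F x y * G x y + pd_y G x y * F x y)"
    using Suc by (auto intro!: Ck_on_add)
  then show ?case
    by (rule Ck_on_SucI[OF Suc.prems(1)])
      (auto intro!: DERIV_mult Ck_on_has_pd_x[OF Suc.prems(2)] Ck_on_has_pd_x[OF Suc.prems(3)]
         Ck_on_has_pd_y[OF Suc.prems(2)] Ck_on_has_pd_y[OF Suc.prems(3)])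
qed

text \<open>The derivative of \<open>inverse F\<close> is a product of \<open>inverse F\<close>
  twice with a derivative of \<open>F\<close>, so the induction keeps the same \<open>F\<close> and
  feeds on its own conclusion.\<close>

lemma Ck_on_inverse:
  "open D \<Longrightarrow> Ck_on k D F \<Longrightarrow> \<forall>(x, y)\<in>D. F x y \<noteq> 0 \<Longrightarrow> Ck_on k D (\<lambda>x y. inverse (F x y))"
proof (induction k)
  case 0
  then show ?case by (auto simp: case_prod_unfold intro!: continuous_on_inverse)
next
  case (Suc k)
  then have inv: "Ck_on k D (\<lambda>x y. inverse (F x y))"
    using Ck_on_SucD by blast
  have "Ck_on k D (\<lambda>x y. -1 * (inverse (F x y) * pd_x F x y * inverse (F x y)))"
    "Ck_on k D (\<lambda>x y. -1 * (inverse (F x y) * pd_y F x y * inverse (F x y)))"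
    using Suc.prems by (intro Ck_on_mult Ck_on_const inv; simp)+
  then show ?case
    by (rule Ck_on_SucI[OF Suc.prems(1)])
      (use Suc.prems(3) in \<open>auto intro!: DERIV_inverse' Ck_on_has_pd_x[OF Suc.prems(2)]
         Ck_on_has_pd_y[OF Suc.prems(2)]\<close>)
qed

text \<open>As for the inverse, the derivative \<open>F' / (2 * sqrt F)\<close> contains only the
  root itself. Strict positivity keeps the denominator away from zero.\<close>

lemma Ck_on_sqrt:
  "open D \<Longrightarrow> Ck_on k D F \<Longrightarrow> \<forall>(x, y)\<in>D. F x y > 0 \<Longrightarrow> Ck_on k D (\<lambda>x y. sqrt (F x y))"
proof (induction k)
  case 0
  then show ?case by (auto simp: case_prod_unfold intro: continuous_on_real_sqrt)
next
  case (Suc k)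
  then have "Ck_on k D (\<lambda>x y. sqrt (F x y))"
    using Ck_on_SucD by blast
  then have "Ck_on k D (\<lambda>x y. inverse (sqrt (F x y)))"
    by (rule Ck_on_inverse[OF Suc.prems(1)]) (use Suc.prems(3) in force)
  then have "Ck_on k D (\<lambda>x y. pd_x F x y * (inverse (sqrt (F x y)) * (1/2)))"
    "Ck_on k D (\<lambda>x y. pd_y F x y * (inverse (sqrt (F x y)) * (1/2)))"
    using Suc.prems by (intro Ck_on_mult Ck_on_const; simp)+
  then show ?case
    by (rule Ck_on_SucI[OF Suc.prems(1)])
      (use Suc.prems(3) in \<open>auto intro!: DERIV_chain2[OF DERIV_real_sqrt, THEN DERIV_cong]
         Ck_on_has_pd_x[OF Suc.prems(2)] Ck_on_has_pd_y[OF Suc.prems(2)] simp: field_simps\<close>)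
qed

lemma smooth2_on_const: "smooth2_on D (\<lambda>x y. l)"
  by (simp add: smooth2_on_def Ck_on_const)

lemma
  assumes "open D" "smooth2_on D F" "smooth2_on D G"
  shows smooth2_on_add: "smooth2_on D (\<lambda>x y. F x y + G x y)"
    and smooth2_on_mult: "smooth2_on D (\<lambda>x y. F x y * G x y)"
  using assms by (auto simp: smooth2_on_def intro: Ck_on_add Ck_on_mult)

lemma smooth2_on_minus: "open D \<Longrightarrow> smooth2_on D F \<Longrightarrow> smooth2_on D (\<lambda>x y. - F x y)"
  using smooth2_on_mult[OF _ smooth2_on_const[of _ "-1"]] by simp

lemma smooth2_on_diff:
  "open D \<Longrightarrow> smooth2_on D F \<Longrightarrow> smooth2_on D G \<Longrightarrow> smooth2_on D (\<lambda>x y. F x y - G x y)"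
  using smooth2_on_add[OF _ _ smooth2_on_minus] by simp

lemma smooth2_on_divide:
  assumes "open D" "smooth2_on D F" "smooth2_on D G" "\<forall>(x, y)\<in>D. G x y \<noteq> 0"
  shows "smooth2_on D (\<lambda>x y. F x y / G x y)"
  unfolding divide_inverse using assms
  by (auto simp: smooth2_on_def intro!: Ck_on_mult Ck_on_inverse)

lemma smooth2_on_sqrt:
  "open D \<Longrightarrow> smooth2_on D F \<Longrightarrow> \<forall>(x, y)\<in>D. F x y > 0 \<Longrightarrow> smooth2_on D (\<lambda>x y. sqrt (F x y))"
  by (simp add: smooth2_on_def Ck_on_sqrt)

lemma
  assumes "smooth2_on D F"
  shows smooth2_on_pd_x: "smooth2_on D (pd_x F)" and smooth2_on_pd_y: "smooth2_on D (pd_y F)"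
  using assms unfolding smooth2_on_def by (metis Ck_on.simps(2))+

lemma
  assumes "smooth2_on D F" "(x, y) \<in> D"
  shows smooth2_on_has_pd_x: "((\<lambda>t. F t y) has_field_derivative pd_x F x y) (at x)"
    and smooth2_on_has_pd_y: "((\<lambda>t. F x t) has_field_derivative pd_y F x y) (at y)"
  using Ck_on_has_pd_x Ck_on_has_pd_y assms unfolding smooth2_on_def by blast+

lemma smooth2_on_continuous: "smooth2_on D F \<Longrightarrow> continuous_on D (\<lambda>(x, y). F x y)"
  unfolding smooth2_on_def by (metis Ck_on.simps(1))

subsection \<open>Linear differential equations\<close>

lemma has_vector_derivative_vec:
  fixes f :: "real \<Rightarrow> 'a::real_normed_vector ^ 'n"
  assumes "\<And>i. ((\<lambda>t. f t $ i) has_vector_derivative f' $ i) (at x within S)"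
  shows "(f has_vector_derivative f') (at x within S)"
  unfolding has_vector_derivative_def has_derivative_within
proof
  show "((\<lambda>y. (1 / norm (y - x)) *\<^sub>R (f y - (f x + (y - x) *\<^sub>R f'))) \<longlongrightarrow> 0) (at x within S)"
    using assms by (intro vec_tendstoI) (simp add: has_vector_derivative_def has_derivative_within)
qed (rule bounded_linear_scaleR_left)

text \<open>The norm on this matrix type is the Frobenius norm, and Cauchy-Schwarz in each row shows
  that it dominates the operator norm.\<close>

lemma norm_matrix_vector_mult_le: "norm (A *v v) \<le> norm A * norm v" for A :: "real ^ 'n ^ 'm"
proof -
  have "norm (A *v v) \<le> L2_set (\<lambda>i. norm (A $ i) * norm v) UNIV"
    unfolding norm_vec_def[of "A *v v"]
    by (intro L2_set_mono) (auto simp: matrix_vector_mul_component Cauchy_Schwarz_ineq2)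
  then show ?thesis
    by (simp add: norm_vec_def[of A] L2_set_left_distrib)
qed

lemma bounded_bilinear_matrix_vector_mult: "bounded_bilinear ((*v) :: real ^ 'n ^ 'm \<Rightarrow> _)"
proof
  show "\<exists>K. \<forall>(A :: real ^ 'n ^ 'm) v. norm (A *v v) \<le> norm A * norm v * K"
    by (intro exI[of _ 1]) (simp add: norm_matrix_vector_mult_le)
qed (simp_all add: matrix_vector_right_distrib matrix_vector_mult_add_rdistrib
    matrix_vector_mult_scaleR scaleR_matrix_vector_assoc)

lemma vector_derivative_diff_bound:
  fixes f :: "real \<Rightarrow> 'a::real_normed_vector"
  assumes "convex S" "\<And>t. t \<in> S \<Longrightarrow> (f has_vector_derivative f' t) (at t within S)"
    and "\<And>t. t \<in> S \<Longrightarrow> norm (f' t) \<le> L" "s \<in> S" "t \<in> S"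
  shows "norm (f t - f s) \<le> L * \<bar>t - s\<bar>"
proof -
  have "onorm (\<lambda>h. h *\<^sub>R f' u) \<le> L" if "u \<in> S" for u
    using assms(3)[OF that] by (intro onorm_le) (auto simp: mult.commute[of L] intro: mult_left_mono)
  then show ?thesis
    using differentiable_bound[of S f "\<lambda>u h. h *\<^sub>R f' u" L t s] assms
    by (auto simp: has_vector_derivative_def)
qed

text \<open>On an interval this short no exponential is needed: the maximum of \<open>norm f\<close> absorbs itself.\<close>

lemma short_gronwall:
  fixes f :: "real \<Rightarrow> 'a::real_normed_vector" and s r t :: real
  defines "S \<equiv> {s - r..s + r}"
  assumes "0 \<le> r" "0 \<le> K" "K * r \<le> 1 / 2" "0 \<le> \<eta>"
    and deriv: "\<And>t. t \<in> S \<Longrightarrow> (f has_vector_derivative f' t) (at t within S)"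
    and bound: "\<And>t. t \<in> S \<Longrightarrow> norm (f' t) \<le> K * norm (f t) + \<eta>"
    and "t \<in> S"
  shows "norm (f t) \<le> 2 * norm (f s) + 2 * r * \<eta>"
proof -
  have "continuous_on S f"
    using deriv by (rule continuous_on_vector_derivative)
  then have "\<exists>m\<in>S. \<forall>t\<in>S. norm (f t) \<le> norm (f m)"
    using assms(8) unfolding S_def by (intro continuous_attains_sup continuous_intros) auto
  then obtain m where m: "m \<in> S" "\<And>t. t \<in> S \<Longrightarrow> norm (f t) \<le> norm (f m)"
    by blast
  have s: "s \<in> S" using assms(2) by (auto simp: S_def)
  have "norm (f' t) \<le> K * norm (f m) + \<eta>" if "t \<in> S" for t
    using bound[OF that] mult_left_mono[OF m(2)[OF that] assms(3)] by linarith
  then have "norm (f m - f s) \<le> (K * norm (f m) + \<eta>) * \<bar>m - s\<bar>"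
    by (intro vector_derivative_diff_bound[OF _ deriv _ s m(1)]) (auto simp: S_def)
  also have "\<dots> \<le> (K * norm (f m) + \<eta>) * r"
    using m(1) assms(3,5) by (intro mult_left_mono) (auto simp: S_def)
  also have "\<dots> = (K * r) * norm (f m) + r * \<eta>"
    by (simp add: algebra_simps)
  \<comment> \<open>Moving half of the maximum to the left and doubling gives both factors 2 of the
    claim.\<close>
  also have "\<dots> \<le> 1 / 2 * norm (f m) + r * \<eta>"
    using assms(4) by (intro add_right_mono mult_right_mono) auto
  finally have "norm (f m) \<le> 2 * norm (f s) + 2 * r * \<eta>"
    using norm_triangle_ineq2[of "f m" "f s"] by linarith
  then show ?thesis
    using m(2)[OF assms(8)] by linarith
qed

text \<open>Picard iteration in the sup norm. The Lipschitz bound is global in the unknown, as it is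
  for linear equations, so no ball around \<open>w0\<close> has to be kept invariant and the length
  of the interval does not depend on \<open>w0\<close>.\<close>

lemma short_ode_exists:
  fixes f :: "real \<Rightarrow> 'a::banach \<Rightarrow> 'a" and w0 :: 'a and s r :: real
  defines "S \<equiv> {s - r..s + r}"
  assumes "0 \<le> r" "0 \<le> K" "K * r \<le> 1 / 2"
    and cont: "\<And>\<phi>. continuous_on S \<phi> \<Longrightarrow> continuous_on S (\<lambda>t. f t (\<phi> t))"
    and lipschitz: "\<And>t v w. t \<in> S \<Longrightarrow> norm (f t v - f t w) \<le> K * norm (v - w)"
  obtains w where "w s = w0" "\<And>t. t \<in> S \<Longrightarrow> (w has_vector_derivative f t (w t)) (at t within S)"
proof -
  have s: "s \<in> S" using assms(2) by (auto simp: S_def)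
  \<comment> \<open>The initial point \<open>s\<close> is the midpoint, and an integral over
    \<open>{s..t}\<close> would vanish for \<open>t < s\<close>. Integrating from the left end and
    subtracting the value at \<open>s\<close> covers both sides.\<close>
  define G where "G \<phi> t = w0 + (integral {s - r..t} (\<lambda>u. f u (\<phi> u)) - integral {s - r..s} (\<lambda>u. f u (\<phi> u)))"
    for \<phi> t
  have G_s: "G \<phi> s = w0" for \<phi>
    by (simp add: G_def)
  have G_deriv: "(G \<phi> has_vector_derivative f t (\<phi> t)) (at t within S)"
    if "continuous_on S \<phi>" "t \<in> S" for \<phi> t
    unfolding G_def S_def
    using has_vector_derivative_add[OF has_vector_derivative_const[of w0]
        has_vector_derivative_diff[OF integral_has_vector_derivative[OF
          cont[OF that(1), unfolded S_def] that(2)[unfolded S_def]]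
        has_vector_derivative_const]]
    by simp
  \<comment> \<open>Bounded continuous functions on the whole line form a complete metric space;
    clamping extends each iterate from \<open>S\<close> by its values at the end points.\<close>
  have "\<exists>\<psi> :: real \<Rightarrow>\<^sub>C 'a. (\<forall>t. \<psi> t = G \<phi> (clamp (s - r) (s + r) t)) \<and> (\<forall>t\<in>S. \<psi> t = G \<phi> t)"
    for \<phi> :: "real \<Rightarrow>\<^sub>C 'a"
  proof -
    have "continuous_on (cbox (s - r) (s + r)) (G \<phi>)"
      using continuous_on_vector_derivative[of S "G \<phi>", OF G_deriv[of \<phi>]] by (simp add: S_def)
    then show ?thesis
      by (rule continuous_on_cbox_bcontfunE) (metis S_def cbox_interval)
  qed
  then obtain T :: "(real \<Rightarrow>\<^sub>C 'a) \<Rightarrow> (real \<Rightarrow>\<^sub>C 'a)" where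
    T: "\<And>\<phi> t. T \<phi> t = G \<phi> (clamp (s - r) (s + r) t)" and T': "\<And>\<phi> t. t \<in> S \<Longrightarrow> T \<phi> t = G \<phi> t"
    by metis
  have "dist (T \<phi>) (T \<psi>) \<le> 1 / 2 * dist \<phi> \<psi>" for \<phi> \<psi>
  proof (rule dist_bound)
    fix t
    define c where "c = clamp (s - r) (s + r) t"
    have c: "c \<in> S"
      using clamp_in_interval[of "s - r" "s + r" t] assms(2) by (auto simp: c_def S_def)
    have "norm (f u (\<phi> u) - f u (\<psi> u)) \<le> K * dist \<phi> \<psi>" if "u \<in> S" for u
      using lipschitz[OF that] mult_left_mono[OF dist_bounded[of \<phi> u \<psi>] assms(3)]
      by (metis dist_norm order_trans)
    \<comment> \<open>Both iterates have the value \<open>w0\<close> at \<open>s\<close>, so the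
      mean value inequality started at \<open>s\<close> bounds their distance at
      \<open>c\<close>.\<close>
    then have "norm ((G \<phi> c - G \<psi> c) - (G \<phi> s - G \<psi> s)) \<le> K * dist \<phi> \<psi> * \<bar>c - s\<bar>"
      by (intro vector_derivative_diff_bound[where f' = "\<lambda>u. f u (\<phi> u) - f u (\<psi> u)", OF _ _ _ s c])
        (auto simp: S_def[symmetric] intro!: has_vector_derivative_diff G_deriv, simp add: S_def)
    also have "\<dots> \<le> K * dist \<phi> \<psi> * r"
      using c assms(3) by (intro mult_left_mono) (auto simp: S_def)
    also have "\<dots> = K * r * dist \<phi> \<psi>"
      by simp
    also have "\<dots> \<le> 1 / 2 * dist \<phi> \<psi>"
      using assms(4) by (intro mult_right_mono) auto
    finally show "dist (T \<phi> t) (T \<psi> t) \<le> 1 / 2 * dist \<phi> \<psi>"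
      by (simp add: G_s T dist_norm c_def)
  qed
  then have "\<exists>!\<phi>. T \<phi> = \<phi>"
    by (intro banach_fix_type[of "1 / 2"]) auto
  then obtain \<phi> where \<phi>: "T \<phi> = \<phi>"
    by blast
  have "(apply_bcontfun \<phi> has_vector_derivative f t (\<phi> t)) (at t within S)" if "t \<in> S" for t
    by (rule has_vector_derivative_transform[OF that _ G_deriv[OF continuous_on_apply_bcontfun that]])
      (use T'[of _ \<phi>] \<phi> in simp_all)
  moreover have "\<phi> s = w0"
    using T'[OF s, of \<phi>] \<phi> G_s by simp
  ultimately show thesis
    using that by blast
qed

text \<open>The defect \<open>E = w(x', y) - w(x, y) - (x' - x) A w(x, y)\<close> satisfies \<open>E\<^sub>y = B(x', y) E + O((x' - x)\<^sup>2)\<close>,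
  precisely because the system is compatible.\<close>

lemma compatible_system_derivative:
  fixes A B Ay Bx :: "real \<Rightarrow> real \<Rightarrow> real ^ 'n ^ 'n" and w :: "real \<Rightarrow> real \<Rightarrow> real ^ 'n"
    and x0 y0 r x y :: real
  defines "I \<equiv> {x0 - r..x0 + r}" and "J \<equiv> {y0 - r..y0 + r}"
  assumes rK: "0 \<le> r" "0 \<le> K" "K * r \<le> 1 / 2" and C: "0 \<le> C"
    and A_bound: "\<And>x y. x \<in> I \<Longrightarrow> y \<in> J \<Longrightarrow> norm (A x y) \<le> K"
    and B_bound: "\<And>x y. x \<in> I \<Longrightarrow> y \<in> J \<Longrightarrow> norm (B x y) \<le> K"
    and B_lip: "\<And>x x' y. x \<in> I \<Longrightarrow> x' \<in> I \<Longrightarrow> y \<in> J \<Longrightarrow> norm (B x' y - B x y) \<le> C * \<bar>x' - x\<bar>"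
    and B_taylor: "\<And>x x' y. x \<in> I \<Longrightarrow> x' \<in> I \<Longrightarrow> y \<in> J \<Longrightarrow>
      norm (B x' y - B x y - (x' - x) *\<^sub>R Bx x y) \<le> C * (x' - x)\<^sup>2"
    and Ay: "\<And>x y. x \<in> I \<Longrightarrow> y \<in> J \<Longrightarrow> (A x has_vector_derivative Ay x y) (at y within J)"
    and compatible: "\<And>x y. x \<in> I \<Longrightarrow> y \<in> J \<Longrightarrow> Ay x y + A x y ** B x y = Bx x y + B x y ** A x y"
    and w_init: "\<And>x. x \<in> I \<Longrightarrow>
      ((\<lambda>t. w t y0) has_vector_derivative A x y0 *v w x y0) (at x within I)"
    and w_y: "\<And>x y. x \<in> I \<Longrightarrow> y \<in> J \<Longrightarrow> (w x has_vector_derivative B x y *v w x y) (at y within J)"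
    and x: "x \<in> I" and y: "y \<in> J"
  shows "((\<lambda>t. w t y) has_vector_derivative A x y *v w x y) (at x within I)"
proof -
  have mv: "norm (M *v v) \<le> L * norm v" if "norm M \<le> L" for M :: "real ^ 'n ^ 'n" and v L
    using norm_matrix_vector_mult_le[of M v] mult_right_mono[OF that norm_ge_zero[of v]] by linarith
  have y0: "y0 \<in> J" using rK by (auto simp: J_def)
  define W where "W = 2 * norm (w x y0)"
  have W: "norm (w x t) \<le> W" if "t \<in> J" for t
    using short_gronwall[of r K 0 y0 "w x" "\<lambda>t. B x t *v w x t" t] rK w_y[OF x] that mv B_bound[OF x]
    by (auto simp: W_def J_def)
  have W0: "0 \<le> W" by (simp add: W_def)
  \<comment> \<open>The two summands bound the two terms of the remainder \<open>R\<close> below: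
    the Taylor error of \<open>B\<close> applied to \<open>w\<close>, and the increment of
    \<open>B\<close> applied to \<open>A w\<close>.\<close>
  define c where "c = C * W + C * (K * W)"
  have c: "0 \<le> c" using C W0 rK by (simp add: c_def)
  have defect: "norm (w x' y - w x y - (x' - x) *\<^sub>R (A x y *v w x y)) \<le>
      2 * norm (w x' y0 - w x y0 - (x' - x) *\<^sub>R (A x y0 *v w x y0)) + 2 * r * (c * (x' - x)\<^sup>2)"
    if x': "x' \<in> I" for x'
  proof -
    define E where "E t = w x' t - w x t - (x' - x) *\<^sub>R (A x t *v w x t)" for t
    define R where "R t = (B x' t - B x t - (x' - x) *\<^sub>R Bx x t) *v w x t
      + (x' - x) *\<^sub>R ((B x' t - B x t) *v (A x t *v w x t))" for t
    have "(E has_vector_derivative B x' t *v E t + R t) (at t within J)" if t: "t \<in> J" for t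
    proof -
      have Aw: "((\<lambda>t. A x t *v w x t) has_vector_derivative
          A x t *v (B x t *v w x t) + Ay x t *v w x t) (at t within J)"
        by (rule bounded_bilinear.has_vector_derivative[OF bounded_bilinear_matrix_vector_mult
              Ay[OF x t] w_y[OF x t]])
      have "(E has_vector_derivative B x' t *v w x' t - B x t *v w x t
          - (x' - x) *\<^sub>R (A x t *v (B x t *v w x t) + Ay x t *v w x t)) (at t within J)"
        unfolding E_def
        by (intro has_vector_derivative_diff w_y x x' t
            bounded_linear.has_vector_derivative[OF bounded_linear_scaleR_right Aw])
      \<comment> \<open>Compatibility replaces the derivative of \<open>A w\<close> by terms in
        \<open>Bx\<close> and \<open>B A\<close>. Apart from \<open>B x' t *v E t\<close>, only
        second order errors in \<open>x' - x\<close> then remain.\<close>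
      moreover have "A x t *v (B x t *v w x t) + Ay x t *v w x t =
          Bx x t *v w x t + B x t *v (A x t *v w x t)"
        using arg_cong[OF compatible[OF x t], of "\<lambda>M. M *v w x t"]
        by (simp add: matrix_vector_mul_assoc matrix_vector_mult_add_rdistrib add.commute)
      moreover have "B x' t *v w x' t - B x t *v w x t
          - (x' - x) *\<^sub>R (Bx x t *v w x t + B x t *v (A x t *v w x t)) = B x' t *v E t + R t"
        by (simp add: E_def R_def matrix_vector_mult_diff_rdistrib matrix_vector_mult_diff_distrib
            matrix_vector_mult_scaleR scaleR_matrix_vector_assoc[symmetric] scaleR_add_right
            scaleR_diff_right)
      ultimately show ?thesis
        by simp
    qed
    moreover have "norm (B x' t *v E t + R t) \<le> K * norm (E t) + c * (x' - x)\<^sup>2" if t: "t \<in> J" for t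
    proof -
      have "norm (A x t *v w x t) \<le> K * W"
        using mv[OF A_bound[OF x t]] mult_left_mono[OF W[OF t] rK(2)] by (rule order_trans)
      then have "norm ((B x' t - B x t) *v (A x t *v w x t)) \<le> C * \<bar>x' - x\<bar> * (K * W)"
        using mv[OF B_lip[OF x x' t], of "A x t *v w x t"] C
        by (meson abs_ge_zero mult_left_mono mult_nonneg_nonneg order_trans)
      then have "norm ((x' - x) *\<^sub>R ((B x' t - B x t) *v (A x t *v w x t))) \<le> \<bar>x' - x\<bar> * (C * \<bar>x' - x\<bar> * (K * W))"
        by (simp add: mult_left_mono)
      also have "\<dots> = C * (K * W) * (x' - x)\<^sup>2"
        by (simp add: power2_eq_square)
      finally have 1: "norm ((x' - x) *\<^sub>R ((B x' t - B x t) *v (A x t *v w x t))) \<le> C * (K * W) * (x' - x)\<^sup>2" .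
      have "norm ((B x' t - B x t - (x' - x) *\<^sub>R Bx x t) *v w x t) \<le> C * (x' - x)\<^sup>2 * W"
        using mv[OF B_taylor[OF x x' t], of "w x t"] W[OF t] C
        by (meson mult_left_mono mult_nonneg_nonneg order_trans zero_le_power2)
      then have "norm (R t) \<le> c * (x' - x)\<^sup>2"
        unfolding R_def c_def using 1 by (intro norm_triangle_le) (simp add: algebra_simps)
      then show ?thesis
        using mv[OF B_bound[OF x' t], of "E t"] by (intro norm_triangle_le) simp
    qed
    ultimately have "norm (E y) \<le> 2 * norm (E y0) + 2 * r * (c * (x' - x)\<^sup>2)"
      using rK c y unfolding J_def by (intro short_gronwall[of r K _ y0 E "\<lambda>t. B x' t *v E t + R t"]) auto
    then show ?thesis
      by (simp add: E_def)
  qed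
  show ?thesis
    unfolding has_vector_derivative_def has_derivative_within_alt
  proof (intro conjI bounded_linear_scaleR_left allI impI)
    fix e :: real assume e: "e > 0"
    \<comment> \<open>The growth estimate doubles the error on the initial line, so
      \<open>e / 4\<close> there costs \<open>e / 2\<close>; the other half is left for the
      quadratic term.\<close>
    obtain d where d: "d > 0" and init: "\<And>x'. x' \<in> I \<Longrightarrow> norm (x' - x) < d \<Longrightarrow>
        norm (w x' y0 - w x y0 - (x' - x) *\<^sub>R (A x y0 *v w x y0)) \<le> e / 4 * norm (x' - x)"
      using w_init[OF x, unfolded has_vector_derivative_def has_derivative_within_alt,
          THEN conjunct2, rule_format, of "e / 4"] e by auto
    \<comment> \<open>This makes \<open>4 * r * c * \<bar>x' - x\<bar> \<le> e\<close>. The added 1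
      protects against a zero denominator.\<close>
    define d' where "d' = min d (e / (4 * r * c + 1))"
    have rc: "0 \<le> r * c" using rK c by simp
    have d': "d' > 0" "d' \<le> d" using d e rc by (auto simp: d'_def intro!: divide_pos_pos add_nonneg_pos)
    have "norm (w x' y - w x y - (x' - x) *\<^sub>R (A x y *v w x y)) \<le> e * norm (x' - x)"
      if x': "x' \<in> I" "norm (x' - x) < d'" for x'
    proof -
      have "norm (x' - x) < e / (4 * r * c + 1)" using x' by (simp add: d'_def)
      then have "norm (x' - x) * (4 * r * c + 1) \<le> e"
        using rc by (simp add: pos_less_divide_eq)
      then have "4 * (r * c * \<bar>x' - x\<bar>) \<le> e"
        by (simp add: algebra_simps)
      then have "4 * (r * c * \<bar>x' - x\<bar>) * \<bar>x' - x\<bar> \<le> e * \<bar>x' - x\<bar>"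
        by (rule mult_right_mono) simp
      then have "2 * r * (c * (x' - x)\<^sup>2) \<le> e / 2 * norm (x' - x)"
        by (simp add: power2_eq_square algebra_simps abs_if split: if_splits)
      then show ?thesis
        using defect[OF x'(1)] init[OF x'(1)] x'(2) d'(2) by simp
    qed
    then show "\<exists>d>0. \<forall>x'\<in>I. norm (x' - x) < d \<longrightarrow>
        norm (w x' y - w x y - (x' - x) *\<^sub>R (A x y *v w x y)) \<le> e * norm (x' - x)"
      using d'(1) by blast
  qed
qed

section \<open>Matrix functions with smooth entries, and the Frobenius theorem\<close>

lemma
  fixes M :: "real \<Rightarrow> real \<Rightarrow> real ^ 'n ^ 'm"
  assumes M: "\<And>i j. smooth2_on D (\<lambda>x y. M x y $ i $ j)" and "(x, y) \<in> D"
  shows smooth_matrix_has_pd_x: "((\<lambda>t. M t y) has_vector_derivative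
      (\<chi> i j. pd_x (\<lambda>x y. M x y $ i $ j) x y)) (at x within S)"
    and smooth_matrix_has_pd_y: "(M x has_vector_derivative
      (\<chi> i j. pd_y (\<lambda>x y. M x y $ i $ j) x y)) (at y within S)"
proof -
  have "((\<lambda>t. M t y $ i $ j) has_vector_derivative pd_x (\<lambda>x y. M x y $ i $ j) x y) (at x within S)"
    "((\<lambda>t. M x t $ i $ j) has_vector_derivative pd_y (\<lambda>x y. M x y $ i $ j) x y) (at y within S)" for i j
    using smooth2_on_has_pd_x[OF M assms(2)] smooth2_on_has_pd_y[OF M assms(2)]
    by (simp_all add: has_real_derivative_iff_has_vector_derivative has_vector_derivative_at_within)
  then show "((\<lambda>t. M t y) has_vector_derivative (\<chi> i j. pd_x (\<lambda>x y. M x y $ i $ j) x y)) (at x within S)"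
    "(M x has_vector_derivative (\<chi> i j. pd_y (\<lambda>x y. M x y $ i $ j) x y)) (at y within S)"
    by (intro has_vector_derivative_vec; simp)+
qed

lemma smooth_matrix_bounded:
  fixes M :: "real \<Rightarrow> real \<Rightarrow> real ^ 'n ^ 'm"
  assumes M: "\<And>i j. smooth2_on D (\<lambda>x y. M x y $ i $ j)" and "compact S" "S \<subseteq> D"
  obtains L where "0 \<le> L" "\<And>x y. (x, y) \<in> S \<Longrightarrow> norm (M x y) \<le> L"
proof -
  have "continuous_on S (\<lambda>z. M (fst z) (snd z) $ i $ j)" for i j
    using continuous_on_subset[OF smooth2_on_continuous[OF M] assms(3)] by (simp add: case_prod_unfold)
  then have "continuous_on S (\<lambda>z. \<chi> i j. M (fst z) (snd z) $ i $ j)"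
    by (intro continuous_on_vec_lambda)
  then have "continuous_on S (\<lambda>z. M (fst z) (snd z))"
    by simp
  then have "bounded ((\<lambda>z. M (fst z) (snd z)) ` S)"
    using assms(2) by (intro compact_imp_bounded compact_continuous_image)
  then obtain L where L: "L > 0" "\<forall>m\<in>(\<lambda>z. M (fst z) (snd z)) ` S. norm m \<le> L"
    unfolding bounded_pos by blast
  show thesis
    by (rule that[of L]) (use L in force)+
qed

lemma Ck_on_sum:
  "open D \<Longrightarrow> finite I \<Longrightarrow> (\<And>i. i \<in> I \<Longrightarrow> Ck_on k D (F i)) \<Longrightarrow> Ck_on k D (\<lambda>x y. \<Sum>i\<in>I. F i x y)"
proof (induction I rule: infinite_finite_induct)
  case (insert i I)
  have "Ck_on k D (\<lambda>x y. F i x y + (\<Sum>i\<in>I. F i x y))"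
    using insert by (intro Ck_on_add) auto
  then show ?case
    using insert.hyps by simp
qed (auto simp: Ck_on_const)

lemma open_contains_square:
  fixes D :: "(real \<times> real) set"
  assumes "open D" "(x0, y0) \<in> D"
  obtains r where "r > 0" "{x0 - r..x0 + r} \<times> {y0 - r..y0 + r} \<subseteq> D"
proof -
  obtain X Y where XY: "open X" "open Y" "x0 \<in> X" "y0 \<in> Y" "X \<times> Y \<subseteq> D"
    using open_prod_elim[OF assms] by (metis mem_Sigma_iff)
  obtain r s where rs: "r > 0" "cball x0 r \<subseteq> X" "s > 0" "cball y0 s \<subseteq> Y"
    using XY open_contains_cball by metis
  have "{x0 - min r s..x0 + min r s} \<subseteq> cball x0 r" "{y0 - min r s..y0 + min r s} \<subseteq> cball y0 s"
    by (auto simp: cball_eq_atLeastAtMost)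
  then have "{x0 - min r s..x0 + min r s} \<times> {y0 - min r s..y0 + min r s} \<subseteq> X \<times> Y"
    using rs by (intro Sigma_mono) blast+
  then show thesis
    using XY(5) rs by (intro that[of "min r s"]) simp_all
qed

text \<open>The neighbourhood \<open>U\<close> is found before \<open>w0\<close> is given: the
  radius depends only on bounds for the coefficients. Two solutions with different initial values
  thus live on the same \<open>U\<close>, as a coordinate system requires.\<close>

lemma linear_frobenius:
  fixes A B :: "real \<Rightarrow> real \<Rightarrow> real ^ 'n ^ 'n"
  assumes D: "open D" "(x0, y0) \<in> D"
    and A: "\<And>i j. smooth2_on D (\<lambda>x y. A x y $ i $ j)"
    and B: "\<And>i j. smooth2_on D (\<lambda>x y. B x y $ i $ j)"
    and compatible: "\<And>x y i j. (x, y) \<in> D \<Longrightarrow>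
      pd_y (\<lambda>x y. A x y $ i $ j) x y + (A x y ** B x y) $ i $ j =
      pd_x (\<lambda>x y. B x y $ i $ j) x y + (B x y ** A x y) $ i $ j"
  obtains U where "open U" "(x0, y0) \<in> U" "U \<subseteq> D"
    "\<And>w0. \<exists>w. w x0 y0 = w0 \<and> (\<forall>i. smooth2_on U (\<lambda>x y. w x y $ i)) \<and>
      (\<forall>(x, y)\<in>U. \<forall>i. pd_x (\<lambda>x y. w x y $ i) x y = (A x y *v w x y) $ i \<and>
        pd_y (\<lambda>x y. w x y $ i) x y = (B x y *v w x y) $ i)"
proof -
  obtain r0 where r0: "r0 > 0" "{x0 - r0..x0 + r0} \<times> {y0 - r0..y0 + r0} \<subseteq> D"
    using open_contains_square[OF D] .
  define Q where "Q = {x0 - r0..x0 + r0} \<times> {y0 - r0..y0 + r0}"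
  have Q: "compact Q" "Q \<subseteq> D"
    using r0 by (auto simp: Q_def intro: compact_Times)
  define Ay where "Ay x y = (\<chi> i j. pd_y (\<lambda>x y. A x y $ i $ j) x y)" for x y
  define Bx where "Bx x y = (\<chi> i j. pd_x (\<lambda>x y. B x y $ i $ j) x y)" for x y
  \<comment> \<open>A bound for \<open>Bxx\<close> makes \<open>Bx\<close> Lipschitz in
    \<open>x\<close>, which yields the quadratic Taylor error of \<open>B\<close>.\<close>
  define Bxx where "Bxx x y = (\<chi> i j. pd_x (\<lambda>x y. Bx x y $ i $ j) x y)" for x y
  have Bx: "smooth2_on D (\<lambda>x y. Bx x y $ i $ j)" for i j
    using smooth2_on_pd_x[OF B[of i j]] by (simp add: Bx_def)
  have Bxx: "smooth2_on D (\<lambda>x y. Bxx x y $ i $ j)" for i j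
    using smooth2_on_pd_x[OF Bx[of i j]] by (simp add: Bxx_def)
  obtain K1 K2 C1 C2 where
    K1: "0 \<le> K1" "\<And>x y. (x, y) \<in> Q \<Longrightarrow> norm (A x y) \<le> K1" and
    K2: "0 \<le> K2" "\<And>x y. (x, y) \<in> Q \<Longrightarrow> norm (B x y) \<le> K2" and
    C1: "0 \<le> C1" "\<And>x y. (x, y) \<in> Q \<Longrightarrow> norm (Bx x y) \<le> C1" and
    C2: "0 \<le> C2" "\<And>x y. (x, y) \<in> Q \<Longrightarrow> norm (Bxx x y) \<le> C2"
    using smooth_matrix_bounded[OF A Q] smooth_matrix_bounded[OF B Q]
      smooth_matrix_bounded[OF Bx Q] smooth_matrix_bounded[OF Bxx Q] by metis
  define K C where "K = K1 + K2" and "C = C1 + C2"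
  have K: "0 \<le> K" and C: "0 \<le> C"
    using K1 K2 C1 C2 by (auto simp: K_def C_def)
  \<comment> \<open>Chosen for \<open>K * r \<le> 1 / 2\<close>; \<open>K + 1\<close> is positive
    even if \<open>K\<close> vanishes.\<close>
  define r where "r = min r0 (1 / (2 * (K + 1)))"
  have r: "0 < r" "r \<le> r0"
    using r0 K by (auto simp: r_def)
  have "K * r \<le> K * (1 / (2 * (K + 1)))"
    using K by (intro mult_left_mono) (auto simp: r_def)
  also have "\<dots> \<le> 1 / 2"
    using K by (simp add: field_simps)
  finally have Kr: "K * r \<le> 1 / 2" .
  define I J where "I = {x0 - r..x0 + r}" and "J = {y0 - r..y0 + r}"
  have IJ: "x0 \<in> I" "y0 \<in> J" "convex I" "convex J"
    using r by (auto simp: I_def J_def)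
  have IJ_Q: "(x, y) \<in> Q" and IJ_D: "(x, y) \<in> D" if "x \<in> I" "y \<in> J" for x y
    using that r Q by (auto simp: I_def J_def Q_def)
  have A_bound: "norm (A x y) \<le> K" and B_bound: "norm (B x y) \<le> K"
    and Bx_bound: "norm (Bx x y) \<le> C" and Bxx_bound: "norm (Bxx x y) \<le> C"
    if "x \<in> I" "y \<in> J" for x y
    using K1 K2 C1 C2 IJ_Q[OF that] by (auto simp: K_def C_def add_increasing add_increasing2)
  have B_x: "((\<lambda>t. B t y) has_vector_derivative Bx x y) (at x within S)"
    and Bx_x: "((\<lambda>t. Bx t y) has_vector_derivative Bxx x y) (at x within S)"
    and B_y: "((\<lambda>t. B x t) has_vector_derivative (\<chi> i j. pd_y (\<lambda>x y. B x y $ i $ j) x y)) (at y within S)"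
    and A_y: "(A x has_vector_derivative Ay x y) (at y within S)"
    and A_x: "((\<lambda>t. A t y) has_vector_derivative (\<chi> i j. pd_x (\<lambda>x y. A x y $ i $ j) x y)) (at x within S)"
    if "x \<in> I" "y \<in> J" for x y S
    using smooth_matrix_has_pd_x[OF B IJ_D[OF that]] smooth_matrix_has_pd_x[OF Bx IJ_D[OF that]]
      smooth_matrix_has_pd_y[OF B IJ_D[OF that]] smooth_matrix_has_pd_y[OF A IJ_D[OF that]]
      smooth_matrix_has_pd_x[OF A IJ_D[OF that]]
    by (simp_all add: Bx_def Bxx_def Ay_def)
  have B_lip: "norm (B x' y - B x y) \<le> C * \<bar>x' - x\<bar>"
    and Bx_lip: "norm (Bx x' y - Bx x y) \<le> C * \<bar>x' - x\<bar>"
    if "x \<in> I" "x' \<in> I" "y \<in> J" for x x' y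
    by (rule vector_derivative_diff_bound[OF IJ(3) B_x Bx_bound]
        vector_derivative_diff_bound[OF IJ(3) Bx_x Bxx_bound]; use that in blast)+
  have B_taylor: "norm (B x' y - B x y - (x' - x) *\<^sub>R Bx x y) \<le> C * (x' - x)\<^sup>2"
    if "x \<in> I" "x' \<in> I" "y \<in> J" for x x' y
  proof -
    have sub: "closed_segment x x' \<subseteq> I"
      using closed_segment_subset[OF that(1,2) IJ(3)] .
    have "norm ((B x' y - (x' - x) *\<^sub>R Bx x y) - (B x y - (x - x) *\<^sub>R Bx x y)) \<le> C * \<bar>x' - x\<bar> * \<bar>x' - x\<bar>"
    \<comment> \<open>The mean value inequality is applied to \<open>B\<close> minus its linear
      part. Working on the segment between \<open>x\<close> and \<open>x'\<close> keeps the
      derivative \<open>Bx t y - Bx x y\<close> below \<open>C * \<bar>x' - x\<bar>\<close>.\<close>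
    proof (rule vector_derivative_diff_bound[where f' = "\<lambda>t. Bx t y - Bx x y"])
      fix t assume t: "t \<in> closed_segment x x'"
      have "((\<lambda>t. (t - x) *\<^sub>R Bx x y) has_vector_derivative 1 *\<^sub>R Bx x y) (at t within closed_segment x x')"
        unfolding has_vector_derivative_def by (auto intro!: derivative_eq_intros)
      then show "((\<lambda>t. B t y - (t - x) *\<^sub>R Bx x y) has_vector_derivative Bx t y - Bx x y)
          (at t within closed_segment x x')"
        using has_vector_derivative_diff[OF B_x[of t y]] t sub that by auto
      have "\<bar>t - x\<bar> \<le> \<bar>x' - x\<bar>"
        using t by (auto simp: closed_segment_eq_real_ivl split: if_splits)
      then show "norm (Bx t y - Bx x y) \<le> C * \<bar>x' - x\<bar>"
        using Bx_lip[OF that(1) _ that(3), of t] t sub mult_left_mono[OF _ C] by (meson order_trans subsetD)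
    qed auto
    moreover have "(B x' y - (x' - x) *\<^sub>R Bx x y) - (B x y - (x - x) *\<^sub>R Bx x y) =
        B x' y - B x y - (x' - x) *\<^sub>R Bx x y"
      by simp
    ultimately show ?thesis
      by (simp only: power2_eq_square mult.assoc abs_mult_self_eq)
  qed
  have compat: "Ay x y + A x y ** B x y = Bx x y + B x y ** A x y" if "x \<in> I" "y \<in> J" for x y
    using compatible[OF IJ_D[OF that]] by (simp add: vec_eq_iff Ay_def Bx_def)
  have mv: "norm (M *v v) \<le> K * norm v" if "norm M \<le> K" for M :: "real ^ 'n ^ 'n" and v
    using norm_matrix_vector_mult_le[of M v] mult_right_mono[OF that norm_ge_zero[of v]] by linarith
  have mv_lip: "norm (M *v v - M *v u) \<le> K * norm (v - u)" if "norm M \<le> K" for M :: "real ^ 'n ^ 'n" and u v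
    using mv[OF that, of "v - u"] by (simp add: matrix_vector_mult_diff_distrib)

  define U where "U = {x0 - r<..<x0 + r} \<times> {y0 - r<..<y0 + r}"
  have U: "open U" "(x0, y0) \<in> U" "U \<subseteq> D"
    using r IJ_D by (auto simp: U_def I_def J_def open_Times)
  have solution: "\<exists>w. w x0 y0 = w0 \<and> (\<forall>i. smooth2_on U (\<lambda>x y. w x y $ i)) \<and>
      (\<forall>(x, y)\<in>U. \<forall>i. pd_x (\<lambda>x y. w x y $ i) x y = (A x y *v w x y) $ i \<and>
        pd_y (\<lambda>x y. w x y $ i) x y = (B x y *v w x y) $ i)" for w0
  proof -
    have cont: "continuous_on I (\<lambda>t. A t y0 *v \<phi> t)" if "continuous_on I \<phi>" for \<phi>
      using continuous_on_vector_derivative[OF A_x[OF _ IJ(2)]] that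
      by (rule bounded_bilinear.continuous_on[OF bounded_bilinear_matrix_vector_mult])
    obtain \<phi> where \<phi>: "\<phi> x0 = w0"
      "\<And>x. x \<in> I \<Longrightarrow> (\<phi> has_vector_derivative A x y0 *v \<phi> x) (at x within I)"
      using short_ode_exists[where s = x0 and r = r and f = "\<lambda>t v. A t y0 *v v" and ?w0.0 = w0,
          folded I_def, OF less_imp_le[OF r(1)] K Kr cont mv_lip[OF A_bound[OF _ IJ(2)]]] by blast
    \<comment> \<open>The vertical solutions are chosen separately for each \<open>x\<close>, so no
      regularity in \<open>x\<close> comes with the choice.\<close>
    have "\<exists>\<psi>. \<psi> y0 = \<phi> x \<and> (\<forall>y\<in>J. (\<psi> has_vector_derivative B x y *v \<psi> y) (at y within J))"
      if x: "x \<in> I" for x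
    proof -
      have cont: "continuous_on J (\<lambda>t. B x t *v \<psi> t)" if "continuous_on J \<psi>" for \<psi>
        using continuous_on_vector_derivative[OF B_y[OF x]] that
        by (rule bounded_bilinear.continuous_on[OF bounded_bilinear_matrix_vector_mult])
      obtain \<psi> where "\<psi> y0 = \<phi> x"
        "\<And>y. y \<in> J \<Longrightarrow> (\<psi> has_vector_derivative B x y *v \<psi> y) (at y within J)"
        using short_ode_exists[where s = y0 and r = r and f = "\<lambda>t v. B x t *v v" and ?w0.0 = "\<phi> x",
            folded J_def, OF less_imp_le[OF r(1)] K Kr cont mv_lip[OF B_bound[OF x]]] by blast
      then show ?thesis
        by blast
    qed
    then obtain w where w: "\<And>x. x \<in> I \<Longrightarrow> w x y0 = \<phi> x"
      "\<And>x y. x \<in> I \<Longrightarrow> y \<in> J \<Longrightarrow> (w x has_vector_derivative B x y *v w x y) (at y within J)"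
      by metis
    have w_init: "((\<lambda>t. w t y0) has_vector_derivative A x y0 *v w x y0) (at x within I)" if "x \<in> I" for x
      using has_vector_derivative_transform[OF that w(1) \<phi>(2)[OF that]] w(1)[OF that] by simp
    have w_x: "((\<lambda>t. w t y) has_vector_derivative A x y *v w x y) (at x within I)"
      if "x \<in> I" "y \<in> J" for x y
      using compatible_system_derivative[of r K C x0 y0 A B Bx Ay w x y, folded I_def J_def]
        r K Kr C A_bound B_bound B_lip B_taylor A_y compat w_init w(2) that by (simp add: less_imp_le)
    \<comment> \<open>A factor 2 from the horizontal estimate and another from the vertical
      one.\<close>
    define W where "W = 4 * norm w0"
    have w_bound: "norm (w x y) \<le> W" if "x \<in> I" "y \<in> J" for x y
    proof -
      have "norm (w x y) \<le> 2 * norm (w x y0)"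
        using short_gronwall[of r K 0 y0 "w x" "\<lambda>t. B x t *v w x t" y] r K Kr w(2)
          mv[OF B_bound] that unfolding J_def by simp
      moreover have "norm (w x y0) \<le> 2 * norm (w x0 y0)"
        using short_gronwall[of r K 0 x0 "\<lambda>t. w t y0" "\<lambda>t. A t y0 *v w t y0" x] r K Kr w_init
          mv[OF A_bound] that IJ unfolding I_def by simp
      ultimately show ?thesis
        using w(1)[OF IJ(1)] \<phi>(1) by (simp add: W_def)
    qed
    have KW: "norm (M *v w x y) \<le> K * W" if "x \<in> I" "y \<in> J" "norm M \<le> K" for x y and M :: "real ^ 'n ^ 'n"
      using mv[OF that(3)] mult_left_mono[OF w_bound[OF that(1,2)] K] by (rule order_trans)
    \<comment> \<open>Derivatives along lines alone do not give joint continuity. Their common bound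
      \<open>K * W\<close> does, by moving first vertically and then horizontally.\<close>
    have w_lip: "norm (w x' y' - w x y) \<le> 2 * K * W * dist (x', y') (x, y)"
      if "x \<in> I" "y \<in> J" "x' \<in> I" "y' \<in> J" for x y x' y'
    proof -
      have KW0: "0 \<le> K * W" using K by (simp add: W_def)
      have "norm (w x' y' - w x' y) \<le> K * W * \<bar>y' - y\<bar>"
        by (rule vector_derivative_diff_bound[OF IJ(4) w(2)]) (use KW B_bound that in auto)
      also have "\<dots> \<le> K * W * dist (x', y') (x, y)"
        using dist_snd_le[of "(x', y')" "(x, y)"] KW0 by (intro mult_left_mono) (auto simp: dist_real_def)
      finally have 1: "norm (w x' y' - w x' y) \<le> K * W * dist (x', y') (x, y)" .
      have "norm (w x' y - w x y) \<le> K * W * \<bar>x' - x\<bar>"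
        by (rule vector_derivative_diff_bound[OF IJ(3) w_x]) (use KW A_bound that in auto)
      also have "\<dots> \<le> K * W * dist (x', y') (x, y)"
        using dist_fst_le[of "(x', y')" "(x, y)"] KW0 by (intro mult_left_mono) (auto simp: dist_real_def)
      finally show ?thesis
        using 1 norm_triangle_ineq[of "w x' y' - w x' y" "w x' y - w x y"] by simp
    qed
    have U_IJ: "x \<in> I" "y \<in> J" if "(x, y) \<in> U" for x y
      using that by (auto simp: U_def I_def J_def)
    have w_cont: "continuous_on U (\<lambda>(x, y). w x y)"
    proof (rule lipschitz_on_continuous_on)
      show "(2 * K * W)-lipschitz_on U (\<lambda>(x, y). w x y)"
        using w_lip U_IJ K by (intro lipschitz_onI) (auto simp: dist_norm W_def)
    qed
    have w_pd_x: "((\<lambda>t. w t y $ i) has_field_derivative (A x y *v w x y) $ i) (at x)"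
      and w_pd_y: "((\<lambda>t. w x t $ i) has_field_derivative (B x y *v w x y) $ i) (at y)"
      if xy: "(x, y) \<in> U" for x y i
    proof -
      have "at x within I = at x" "at y within J = at y"
        using xy by (auto simp: U_def I_def J_def intro!: at_within_Icc_at)
      then show "((\<lambda>t. w t y $ i) has_field_derivative (A x y *v w x y) $ i) (at x)"
        "((\<lambda>t. w x t $ i) has_field_derivative (B x y *v w x y) $ i) (at y)"
        using w_x[OF U_IJ[OF xy]] w(2)[OF U_IJ[OF xy]] unfolding has_real_derivative_iff_has_vector_derivative
        by (metis bounded_linear.has_vector_derivative[OF bounded_linear_vec_nth])+
    qed
    \<comment> \<open>Bootstrapping: the system expresses the derivatives of \<open>w\<close>
      through smooth coefficients and \<open>w\<close> itself, so each order of smoothness yields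
      the next.\<close>
    have "Ck_on k U (\<lambda>x y. w x y $ i)" for k i
    proof (induction k arbitrary: i)
      case 0
      show ?case
        using bounded_linear.continuous_on[OF bounded_linear_vec_nth w_cont] by (simp add: case_prod_unfold)
    next
      case (Suc k)
      have A_U: "Ck_on k U (\<lambda>x y. A x y $ i $ j)" and B_U: "Ck_on k U (\<lambda>x y. B x y $ i $ j)" for j
        using A B smooth2_on_subset[OF _ U(3)] by (auto simp: smooth2_on_def)
      have "Ck_on k U (\<lambda>x y. (A x y *v w x y) $ i)" "Ck_on k U (\<lambda>x y. (B x y *v w x y) $ i)"
        using U(1) Suc.IH A_U B_U unfolding matrix_vector_mult_def
        by (auto intro!: Ck_on_sum Ck_on_mult)
      then show ?case
        by (rule Ck_on_SucI[OF U(1)]) (rule w_pd_x w_pd_y, assumption)+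
    qed
    moreover have "w x0 y0 = w0"
      using w(1)[OF IJ(1)] \<phi>(1) by simp
    moreover have "pd_x (\<lambda>x y. w x y $ i) x y = (A x y *v w x y) $ i"
      "pd_y (\<lambda>x y. w x y $ i) x y = (B x y *v w x y) $ i" if "(x, y) \<in> U" for x y i
      unfolding pd_x_def pd_y_def using w_pd_x[OF that] w_pd_y[OF that] by (auto intro: DERIV_imp_deriv)
    ultimately show ?thesis
      by (intro exI[of _ w]) (auto simp: smooth2_on_def)
  qed
  show thesis
    by (rule that[OF U solution])
qed

subsection \<open>Flat coordinates\<close>

lemma
  assumes "smooth2_on D F" "(x, y) \<in> D"
  shows pd_x_minus: "pd_x (\<lambda>x y. - F x y) x y = - pd_x F x y"
    and pd_y_minus: "pd_y (\<lambda>x y. - F x y) x y = - pd_y F x y"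
  unfolding pd_x_def[of "\<lambda>x y. - F x y"] pd_y_def[of "\<lambda>x y. - F x y"]
  by (intro DERIV_imp_deriv DERIV_minus smooth2_on_has_pd_x[OF assms] smooth2_on_has_pd_y[OF assms])+

text \<open>A function is affine for the connection exactly if \<open>(u, u\<^sub>x, u\<^sub>y)\<close> solves a linear total system,
  whose compatibility is the vanishing of the curvature.\<close>

lemma flat_connection_affine_functions:
  assumes D: "open D" "(x0, y0) \<in> D"
    and smooth: "smooth2_on D a" "smooth2_on D b" "smooth2_on D c"
      "smooth2_on D d" "smooth2_on D e" "smooth2_on D f"
    and flat: "\<And>x y. (x, y) \<in> D \<Longrightarrow> pd_y a x y - pd_x b x y + b x y * e x y - c x y * d x y = 0"
      "\<And>x y. (x, y) \<in> D \<Longrightarrow> pd_y d x y - pd_x e x y + b x y * d x y + (e x y)\<^sup>2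
        - a x y * e x y - d x y * f x y = 0"
      "\<And>x y. (x, y) \<in> D \<Longrightarrow> pd_y b x y - pd_x c x y + a x y * c x y + b x y * f x y
        - (b x y)\<^sup>2 - c x y * e x y = 0"
      "\<And>x y. (x, y) \<in> D \<Longrightarrow> pd_y e x y - pd_x f x y + c x y * d x y - b x y * e x y = 0"
  obtains U where "open U" "(x0, y0) \<in> U" "U \<subseteq> D"
    "\<And>p0 q0. \<exists>u. smooth2_on U u \<and> pd_x u x0 y0 = p0 \<and> pd_y u x0 y0 = q0 \<and>
      (\<forall>(x, y)\<in>U.
        pd_x (pd_x u) x y = - (a x y * pd_x u x y + d x y * pd_y u x y) \<and>
        pd_y (pd_x u) x y = - (b x y * pd_x u x y + e x y * pd_y u x y) \<and>
        pd_x (pd_y u) x y = - (b x y * pd_x u x y + e x y * pd_y u x y) \<and>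
        pd_y (pd_y u) x y = - (c x y * pd_x u x y + f x y * pd_y u x y))"
proof -
  define A :: "real \<Rightarrow> real \<Rightarrow> real ^ 3 ^ 3" where
    "A x y = vector [vector [0, 1, 0], vector [0, - a x y, - d x y], vector [0, - b x y, - e x y]]" for x y
  define B :: "real \<Rightarrow> real \<Rightarrow> real ^ 3 ^ 3" where
    "B x y = vector [vector [0, 0, 1], vector [0, - b x y, - e x y], vector [0, - c x y, - f x y]]" for x y
  have pd_const: "pd_x (\<lambda>x y. l) x y = 0" "pd_y (\<lambda>x y. l) x y = 0" for l x y
    by (simp_all add: pd_x_def pd_y_def)
  have A_smooth: "\<forall>i j. smooth2_on D (\<lambda>x y. A x y $ i $ j)"
    and B_smooth: "\<forall>i j. smooth2_on D (\<lambda>x y. B x y $ i $ j)"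
    using smooth by (simp_all add: A_def B_def forall_3 smooth2_on_const smooth2_on_minus[OF D(1)])
  \<comment> \<open>The first row holds because both mixed derivatives are prescribed by the same
    \<open>b\<close> and \<open>e\<close>, that is, by absence of torsion. The lower right block
    consists of the four flatness equations.\<close>
  have compatible: "\<forall>i j. pd_y (\<lambda>x y. A x y $ i $ j) x y + (A x y ** B x y) $ i $ j =
      pd_x (\<lambda>x y. B x y $ i $ j) x y + (B x y ** A x y) $ i $ j" if "(x, y) \<in> D" for x y
    using flat[OF that] by (simp add: A_def B_def forall_3 matrix_matrix_mult_def sum_3 pd_const
        pd_x_minus[OF smooth(2) that] pd_x_minus[OF smooth(3) that] pd_x_minus[OF smooth(5) that]
        pd_x_minus[OF smooth(6) that] pd_y_minus[OF smooth(1) that] pd_y_minus[OF smooth(2) that]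
        pd_y_minus[OF smooth(4) that] pd_y_minus[OF smooth(5) that] power2_eq_square algebra_simps)
  show thesis
  proof (rule linear_frobenius[OF D A_smooth[rule_format] B_smooth[rule_format] compatible[rule_format]])
    fix U
    assume U: "open U" "(x0, y0) \<in> U" "U \<subseteq> D" and
      sol: "\<And>w0. \<exists>w. w x0 y0 = w0 \<and> (\<forall>i. smooth2_on U (\<lambda>x y. w x y $ i)) \<and>
        (\<forall>(x, y)\<in>U. \<forall>i. pd_x (\<lambda>x y. w x y $ i) x y = (A x y *v w x y) $ i \<and>
          pd_y (\<lambda>x y. w x y $ i) x y = (B x y *v w x y) $ i)"
    have "\<exists>u. smooth2_on U u \<and> pd_x u x0 y0 = p0 \<and> pd_y u x0 y0 = q0 \<and>
      (\<forall>(x, y)\<in>U.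
        pd_x (pd_x u) x y = - (a x y * pd_x u x y + d x y * pd_y u x y) \<and>
        pd_y (pd_x u) x y = - (b x y * pd_x u x y + e x y * pd_y u x y) \<and>
        pd_x (pd_y u) x y = - (b x y * pd_x u x y + e x y * pd_y u x y) \<and>
        pd_y (pd_y u) x y = - (c x y * pd_x u x y + f x y * pd_y u x y))" for p0 q0
    proof -
      \<comment> \<open>Affine functions are determined up to an additive constant, so the value at
        the base point is set to 0 and only the gradient is prescribed.\<close>
      obtain w :: "real \<Rightarrow> real \<Rightarrow> real ^ 3" where w: "w x0 y0 = vector [0, p0, q0]"
        "\<And>i. smooth2_on U (\<lambda>x y. w x y $ i)"
        "\<And>x y i. (x, y) \<in> U \<Longrightarrow> pd_x (\<lambda>x y. w x y $ i) x y = (A x y *v w x y) $ i"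
        "\<And>x y i. (x, y) \<in> U \<Longrightarrow> pd_y (\<lambda>x y. w x y $ i) x y = (B x y *v w x y) $ i"
        using sol[of "vector [0, p0, q0]"] by blast
      define u where "u x y = w x y $ 1" for x y
      note expand = A_def B_def matrix_vector_mult_def sum_3
      have u_x: "pd_x u x y = w x y $ 2" and u_y: "pd_y u x y = w x y $ 3" if "(x, y) \<in> U" for x y
        using w(3,4)[OF that, of 1] by (simp_all add: u_def[abs_def] expand)
      have "pd_x (pd_x u) x y = pd_x (\<lambda>x y. w x y $ 2) x y" "pd_y (pd_x u) x y = pd_y (\<lambda>x y. w x y $ 2) x y"
        "pd_x (pd_y u) x y = pd_x (\<lambda>x y. w x y $ 3) x y" "pd_y (pd_y u) x y = pd_y (\<lambda>x y. w x y $ 3) x y"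
        if "(x, y) \<in> U" for x y
        using u_x u_y by (auto intro!: pd_x_cong[OF U(1) that] pd_y_cong[OF U(1) that])
      then show ?thesis
        using w(2)[of 1] w(1) U(2) w(3,4)[of _ _ 2] w(3,4)[of _ _ 3]
        by (intro exI[of _ u]) (auto simp: u_x u_y expand u_def[abs_def, symmetric])
    qed
    then show thesis
      by (rule that[OF U])
  qed
qed

text \<open>The injectivity half of the inverse function theorem: the derivative has a left inverse
  at the point and varies continuously in operator norm.\<close>

lemma smooth_locally_injective:
  assumes U: "open U" "(x0, y0) \<in> U" and u: "smooth2_on U u" and v: "smooth2_on U v"
    and jacobian: "pd_x u x0 y0 * pd_y v x0 y0 - pd_y u x0 y0 * pd_x v x0 y0 \<noteq> 0"
  obtains r where "r > 0" "ball (x0, y0) r \<subseteq> U" "inj_on (\<lambda>(x, y). (u x y, v x y)) (ball (x0, y0) r)"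
proof -
  define L where "L z h = (pd_x u (fst z) (snd z) * fst h + pd_y u (fst z) (snd z) * snd h,
    pd_x v (fst z) (snd z) * fst h + pd_y v (fst z) (snd z) * snd h)" for z h :: "real \<times> real"
  define j where "j = pd_x u x0 y0 * pd_y v x0 y0 - pd_y u x0 y0 * pd_x v x0 y0"
  \<comment> \<open>Cramer's rule for the inverse of the Jacobian matrix.\<close>
  define G where "G k = ((pd_y v x0 y0 * fst k - pd_y u x0 y0 * snd k) / j,
    (pd_x u x0 y0 * snd k - pd_x v x0 y0 * fst k) / j)" for k :: "real \<times> real"
  have "linear G"
    by (rule linearI) (simp_all add: G_def field_simps add_divide_distrib diff_divide_distrib)
  then have G: "bounded_linear G"
    by (simp add: linear_conv_bounded_linear)
  have GL: "G \<circ> L (x0, y0) = id"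
  proof
    fix h :: "real \<times> real"
    have "pd_y v x0 y0 * (pd_x u x0 y0 * fst h + pd_y u x0 y0 * snd h)
        - pd_y u x0 y0 * (pd_x v x0 y0 * fst h + pd_y v x0 y0 * snd h) = j * fst h"
      "pd_x u x0 y0 * (pd_x v x0 y0 * fst h + pd_y v x0 y0 * snd h)
        - pd_x v x0 y0 * (pd_x u x0 y0 * fst h + pd_y u x0 y0 * snd h) = j * snd h"
      by (simp_all add: j_def algebra_simps)
    then show "(G \<circ> L (x0, y0)) h = id h"
      using jacobian by (simp add: G_def L_def j_def[symmetric])
  qed
  have deriv: "((\<lambda>(x, y). (u x y, v x y)) has_derivative L z) (at z)" if "z \<in> U" for z
  proof -
    have z: "(fst z, snd z) \<in> U" using that by simp
    have "Ck_on (Suc 0) U u" "Ck_on (Suc 0) U v"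
      using u v unfolding smooth2_on_def by blast+
    from has_derivative_Pair[OF C1_has_derivative[OF U(1) this(1) z] C1_has_derivative[OF U(1) this(2) z]]
    show ?thesis
      by (simp add: L_def[abs_def] case_prod_unfold)
  qed
  \<comment> \<open>The sum of the moduli of the entries dominates the operator norm of the
    difference, and it is visibly continuous.\<close>
  define \<Delta> where "\<Delta> z = \<bar>pd_x u (fst z) (snd z) - pd_x u x0 y0\<bar> + \<bar>pd_y u (fst z) (snd z) - pd_y u x0 y0\<bar>
    + \<bar>pd_x v (fst z) (snd z) - pd_x v x0 y0\<bar> + \<bar>pd_y v (fst z) (snd z) - pd_y v x0 y0\<bar>" for z
  have onorm_\<Delta>: "onorm (\<lambda>h. L z h - L (x0, y0) h) \<le> \<Delta> z" for z
  proof (rule onorm_le)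
    fix h :: "real \<times> real"
    have h: "\<bar>fst h\<bar> \<le> norm h" "\<bar>snd h\<bar> \<le> norm h"
      by (metis norm_fst_le norm_snd_le prod.collapse real_norm_def)+
    let ?P = "pd_x u (fst z) (snd z) - pd_x u x0 y0" and ?Q = "pd_y u (fst z) (snd z) - pd_y u x0 y0"
      and ?R = "pd_x v (fst z) (snd z) - pd_x v x0 y0" and ?S = "pd_y v (fst z) (snd z) - pd_y v x0 y0"
    have "norm (L z h - L (x0, y0) h) = norm (?P * fst h + ?Q * snd h, ?R * fst h + ?S * snd h)"
      by (simp add: L_def algebra_simps)
    also have "\<dots> \<le> norm (?P * fst h + ?Q * snd h) + norm (?R * fst h + ?S * snd h)"
      by (rule norm_Pair_le)
    also have "\<dots> \<le> (\<bar>?P * fst h\<bar> + \<bar>?Q * snd h\<bar>) + (\<bar>?R * fst h\<bar> + \<bar>?S * snd h\<bar>)"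
      unfolding real_norm_def by (intro add_mono abs_triangle_ineq)
    also have "\<dots> \<le> (\<bar>?P\<bar> * norm h + \<bar>?Q\<bar> * norm h) + (\<bar>?R\<bar> * norm h + \<bar>?S\<bar> * norm h)"
      unfolding abs_mult by (intro add_mono mult_left_mono h abs_ge_zero)
    also have "\<dots> = \<Delta> z * norm h"
      by (simp add: \<Delta>_def algebra_simps)
    finally show "norm (L z h - L (x0, y0) h) \<le> \<Delta> z * norm h" .
  qed
  have "continuous_on U \<Delta>"
    unfolding \<Delta>_def[abs_def]
    by (intro continuous_intros smooth2_on_continuous[unfolded case_prod_unfold]
        smooth2_on_pd_x smooth2_on_pd_y u v)
  then have "(\<Delta> \<longlongrightarrow> \<Delta> (x0, y0)) (at (x0, y0))"
    using U by (simp add: continuous_on_eq_continuous_at continuous_at)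
  then have \<Delta>_lim: "(\<Delta> \<longlongrightarrow> 0) (at (x0, y0))"
    by (simp add: \<Delta>_def)
  show thesis
  proof (rule has_derivative_locally_injective[OF U(2,1) G GL deriv])
    fix \<epsilon> :: real assume "\<epsilon> > 0"
    then have "\<forall>\<^sub>F z in at (x0, y0). \<Delta> z < \<epsilon>"
      using order_tendstoD(2)[OF \<Delta>_lim] by blast
    then obtain \<rho> where \<rho>: "\<rho> > 0" "\<And>z. z \<noteq> (x0, y0) \<Longrightarrow> dist z (x0, y0) < \<rho> \<Longrightarrow> \<Delta> z < \<epsilon>"
      unfolding eventually_at by blast
    have "\<Delta> z < \<epsilon>" if "dist (x0, y0) z < \<rho>" for z
      using \<rho>(2)[of z] that \<open>\<epsilon> > 0\<close> by (cases "z = (x0, y0)") (auto simp: \<Delta>_def dist_commute)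
    then show "\<exists>\<rho>>0. \<forall>z. dist (x0, y0) z < \<rho> \<longrightarrow> onorm (\<lambda>h. L z h - L (x0, y0) h) < \<epsilon>"
      using \<rho>(1) onorm_\<Delta> le_less_trans by blast
  qed (use that in auto)
qed

text \<open>In affine coordinates the geodesics are straight lines, and the connection enters \<open>d\<^sup>2v/du\<^sup>2\<close>
  only through its projective part.\<close>

lemma prolong2_affine_coordinates:
  assumes U: "(x, y) \<in> U" and u: "smooth2_on U u" and v: "smooth2_on U v"
    and affine: "\<And>w. w = u \<or> w = v \<Longrightarrow>
        pd_x (pd_x w) x y = - (a * pd_x w x y + d * pd_y w x y) \<and>
        pd_y (pd_x w) x y = - (b * pd_x w x y + e * pd_y w x y) \<and>
        pd_x (pd_y w) x y = - (b * pd_x w x y + e * pd_y w x y) \<and>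
        pd_y (pd_y w) x y = - (c * pd_x w x y + f * pd_y w x y)"
    and transversal: "total_deriv0 u x y p \<noteq> 0"
  shows "prolong2 u v x y p q =
    (pd_x u x y * pd_y v x y - pd_y u x y * pd_x v x y) *
    (q + c * p ^ 3 - (f - 2 * b) * p\<^sup>2 + (a - 2 * e) * p - d) / total_deriv0 u x y p ^ 3"
proof -
  have total: "total_deriv0 w = (\<lambda>x y p. pd_x w x y + p * pd_y w x y)" for w
    by (intro ext) (simp add: total_deriv0_def pd_x_def pd_y_def)
  define M where "M = pd_x u x y + p * pd_y u x y"
  define N where "N = pd_x v x y + p * pd_y v x y"
  have M0: "M \<noteq> 0" using transversal by (simp add: total M_def)
  note pd = smooth2_on_has_pd_x[OF smooth2_on_pd_x U] smooth2_on_has_pd_x[OF smooth2_on_pd_y U]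
    smooth2_on_has_pd_y[OF smooth2_on_pd_x U] smooth2_on_has_pd_y[OF smooth2_on_pd_y U]
  let ?Mx = "pd_x (pd_x u) x y + p * pd_x (pd_y u) x y" and ?Nx = "pd_x (pd_x v) x y + p * pd_x (pd_y v) x y"
  let ?My = "pd_y (pd_x u) x y + p * pd_y (pd_y u) x y" and ?Ny = "pd_y (pd_x v) x y + p * pd_y (pd_y v) x y"
  have "((\<lambda>t. prolong1 u v t y p) has_field_derivative (?Nx * M - N * ?Mx) / (M * M)) (at x)"
    unfolding prolong1_def total M_def N_def
    by (rule DERIV_divide) (use M0 in \<open>auto simp: M_def intro!: DERIV_add DERIV_cmult pd u v\<close>)
  moreover have "((\<lambda>t. prolong1 u v x t p) has_field_derivative (?Ny * M - N * ?My) / (M * M)) (at y)"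
    unfolding prolong1_def total M_def N_def
    by (rule DERIV_divide) (use M0 in \<open>auto simp: M_def intro!: DERIV_add DERIV_cmult pd u v\<close>)
  moreover have "((\<lambda>t. prolong1 u v x y t) has_field_derivative
      (pd_y v x y * M - N * pd_y u x y) / (M * M)) (at p)"
    unfolding prolong1_def total M_def N_def
    by (rule DERIV_divide) (use M0 in \<open>auto simp: M_def intro!: derivative_eq_intros\<close>)
  ultimately have "total_deriv1 (prolong1 u v) x y p q =
      (?Nx * M - N * ?Mx) / (M * M) + p * ((?Ny * M - N * ?My) / (M * M))
        + q * ((pd_y v x y * M - N * pd_y u x y) / (M * M))"
    unfolding total_deriv1_def by (simp only: DERIV_imp_deriv)
  also have "\<dots> = ((?Nx + p * ?Ny + q * pd_y v x y) * M - N * (?Mx + p * ?My + q * pd_y u x y)) / (M * M)"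
    using M0 by (simp add: field_simps)
  \<comment> \<open>With \<open>X = - (a + 2 * b * p + c * p\<^sup>2)\<close> and
    \<open>Y = q - (d + 2 * e * p + f * p\<^sup>2)\<close>, the second total derivative of either
    coordinate \<open>w\<close> is \<open>X * pd_x w + Y * pd_y w\<close>. The antisymmetric
    combination leaves the Jacobian times \<open>Y - p * X\<close>, which is the cubic
    expression.\<close>
  also have "(?Nx + p * ?Ny + q * pd_y v x y) * M - N * (?Mx + p * ?My + q * pd_y u x y) =
      (pd_x u x y * pd_y v x y - pd_y u x y * pd_x v x y) *
      (q + c * p ^ 3 - (f - 2 * b) * p\<^sup>2 + (a - 2 * e) * p - d)"
    using affine[of u] affine[of v]
    by (simp add: M_def N_def power2_eq_square power3_eq_cube) (simp add: algebra_simps)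
  finally show ?thesis
    by (simp add: prolong2_def total M_def power3_eq_cube)
qed

text \<open>The second derivative of \<open>v\<close> by \<open>u\<close> is the second order
  expression times the Jacobian over a power of \<open>total_deriv0 u\<close>. Both are nonzero
  where the equivalence is claimed, so the zero functions serve as coefficients of the linear
  equation.\<close>

lemma flat_connection_transformable_to_linear:
  assumes D: "open D"
    and smooth: "smooth2_on D a" "smooth2_on D b" "smooth2_on D c"
      "smooth2_on D d" "smooth2_on D e" "smooth2_on D f"
    and flat: "\<And>x y. (x, y) \<in> D \<Longrightarrow> pd_y a x y - pd_x b x y + b x y * e x y - c x y * d x y = 0"
      "\<And>x y. (x, y) \<in> D \<Longrightarrow> pd_y d x y - pd_x e x y + b x y * d x y + (e x y)\<^sup>2
        - a x y * e x y - d x y * f x y = 0"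
      "\<And>x y. (x, y) \<in> D \<Longrightarrow> pd_y b x y - pd_x c x y + a x y * c x y + b x y * f x y
        - (b x y)\<^sup>2 - c x y * e x y = 0"
      "\<And>x y. (x, y) \<in> D \<Longrightarrow> pd_y e x y - pd_x f x y + c x y * d x y - b x y * e x y = 0"
    and h: "\<And>x y. (x, y) \<in> D \<Longrightarrow> h x y = a x y - 2 * e x y"
    and g: "\<And>x y. (x, y) \<in> D \<Longrightarrow> g x y = f x y - 2 * b x y"
  shows "transformable_to_linear D (cubic_ode2 c g h d)"
  unfolding transformable_to_linear_def
proof
  fix z assume z: "z \<in> D"
  obtain x0 y0 where z_eq: "z = (x0, y0)" by (cases z)
  obtain U where U: "open U" "(x0, y0) \<in> U" "U \<subseteq> D" and
    sol: "\<And>p0 q0. \<exists>u. smooth2_on U u \<and> pd_x u x0 y0 = p0 \<and> pd_y u x0 y0 = q0 \<and>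
      (\<forall>(x, y)\<in>U.
        pd_x (pd_x u) x y = - (a x y * pd_x u x y + d x y * pd_y u x y) \<and>
        pd_y (pd_x u) x y = - (b x y * pd_x u x y + e x y * pd_y u x y) \<and>
        pd_x (pd_y u) x y = - (b x y * pd_x u x y + e x y * pd_y u x y) \<and>
        pd_y (pd_y u) x y = - (c x y * pd_x u x y + f x y * pd_y u x y))"
    using flat_connection_affine_functions[OF D z[unfolded z_eq] smooth flat] by blast
  define affine where "affine w \<longleftrightarrow> (\<forall>(x, y)\<in>U.
        pd_x (pd_x w) x y = - (a x y * pd_x w x y + d x y * pd_y w x y) \<and>
        pd_y (pd_x w) x y = - (b x y * pd_x w x y + e x y * pd_y w x y) \<and>
        pd_x (pd_y w) x y = - (b x y * pd_x w x y + e x y * pd_y w x y) \<and>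
        pd_y (pd_y w) x y = - (c x y * pd_x w x y + f x y * pd_y w x y))" for w
  \<comment> \<open>The gradients \<open>(1, 0)\<close> and \<open>(0, 1)\<close> give the Jacobian
    the value 1 at the base point.\<close>
  obtain u where u: "smooth2_on U u" "pd_x u x0 y0 = 1" "pd_y u x0 y0 = 0" "affine u"
    using sol[of 1 0] unfolding affine_def by blast
  obtain v where v: "smooth2_on U v" "pd_x v x0 y0 = 0" "pd_y v x0 y0 = 1" "affine v"
    using sol[of 0 1] unfolding affine_def by blast
  define j where "j x y = pd_x u x y * pd_y v x y - pd_y u x y * pd_x v x y" for x y
  have j0: "j x0 y0 = 1"
    by (simp add: j_def u v)
  obtain r where r: "r > 0" "ball (x0, y0) r \<subseteq> U" "inj_on (\<lambda>(x, y). (u x y, v x y)) (ball (x0, y0) r)"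
    using smooth_locally_injective[OF U(1,2) u(1) v(1)] j0 unfolding j_def by auto
  have "smooth2_on U j"
    unfolding j_def[abs_def]
    by (intro smooth2_on_diff smooth2_on_mult smooth2_on_pd_x smooth2_on_pd_y u v U)
  then have "continuous_on (ball (x0, y0) r) (\<lambda>(x, y). j x y)"
    using smooth2_on_continuous continuous_on_subset r(2) by blast
  then have "open (ball (x0, y0) r \<inter> (\<lambda>(x, y). j x y) -` (- {0}))"
    by (intro continuous_open_preimage) auto
  moreover define V where "V = ball (x0, y0) r \<inter> (\<lambda>(x, y). j x y) -` (- {0})"
  ultimately have V: "open V" "z \<in> V" "V \<subseteq> U" "\<And>x y. (x, y) \<in> V \<Longrightarrow> j x y \<noteq> 0"
    using r j0 by (auto simp: z_eq)
  have transformation: "invertible_point_transformation V u v"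
    unfolding invertible_point_transformation_def
    using V(3,4) smooth2_on_subset[OF u(1)] smooth2_on_subset[OF v(1)] inj_on_subset[OF r(3), of V]
    by (auto simp: j_def V_def)
  have smooth0: "smooth1_on S (\<lambda>_. 0)" for S
  proof -
    have "(deriv ^^ k) (\<lambda>_. 0) = (\<lambda>_. 0 :: real)" for k
      by (induction k) auto
    then show ?thesis by (simp add: smooth1_on_def)
  qed
  have equivalent: "cubic_ode2 c g h d x y p q = 0 \<longleftrightarrow>
      linear_ode2 (\<lambda>_. 0) (\<lambda>_. 0) (\<lambda>_. 0) (u x y) (v x y) (prolong1 u v x y p) (prolong2 u v x y p q) = 0"
    if xy: "(x, y) \<in> V" and transversal: "total_deriv0 u x y p \<noteq> 0" for x y p q
  proof -
    have xyU: "(x, y) \<in> U" and xyD: "(x, y) \<in> D"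
      using xy V(3) U(3) by auto
    have "prolong2 u v x y p q = j x y *
        (q + c x y * p ^ 3 - (f x y - 2 * b x y) * p\<^sup>2 + (a x y - 2 * e x y) * p - d x y)
        / total_deriv0 u x y p ^ 3"
      unfolding j_def
      by (rule prolong2_affine_coordinates[OF xyU u(1) v(1) _ transversal])
        (use u(4) v(4) xyU in \<open>auto simp: affine_def\<close>)
    also have "\<dots> = j x y * cubic_ode2 c g h d x y p q / total_deriv0 u x y p ^ 3"
      by (simp add: cubic_ode2_def g[OF xyD] h[OF xyD])
    finally show ?thesis
      using V(4)[OF xy] transversal by (simp add: linear_ode2_def)
  qed
  show "\<exists>U u v k1 k0 m.
        open U \<and> z \<in> U \<and> U \<subseteq> D \<and> invertible_point_transformation U u v \<and>
        smooth1_on ((\<lambda>(x, y). u x y) ` U) k1 \<and>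
        smooth1_on ((\<lambda>(x, y). u x y) ` U) k0 \<and>
        smooth1_on ((\<lambda>(x, y). u x y) ` U) m \<and>
        (\<forall>(x, y)\<in>U. \<forall>p q. total_deriv0 u x y p \<noteq> 0 \<longrightarrow>
           (cubic_ode2 c g h d x y p q = 0 \<longleftrightarrow>
            linear_ode2 k1 k0 m (u x y) (v x y) (prolong1 u v x y p) (prolong2 u v x y p q) = 0))"
    using V(1-3) U(3) transformation smooth0 equivalent
    by (intro exI[of _ V] exI[of _ u] exI[of _ v] exI[of _ "\<lambda>_. 0"]) blast
qed

subsection \<open>Differentiating the second order equation\<close>

lemma total_deriv2_cubic_ode2:
  assumes smooth: "smooth2_on D c" "smooth2_on D g" "smooth2_on D h" "smooth2_on D d" and "(x, y) \<in> D"
  shows "total_deriv2 (cubic_ode2 c g h d) x y p q r =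
    (pd_x c x y * p ^ 3 - pd_x g x y * p\<^sup>2 + pd_x h x y * p - pd_x d x y)
    + p * (pd_y c x y * p ^ 3 - pd_y g x y * p\<^sup>2 + pd_y h x y * p - pd_y d x y)
    + q * (3 * c x y * p\<^sup>2 - 2 * g x y * p + h x y) + r"
proof -
  note pd = smooth[THEN smooth2_on_has_pd_x[OF _ assms(5)]] smooth[THEN smooth2_on_has_pd_y[OF _ assms(5)]]
  have "((\<lambda>t. cubic_ode2 c g h d t y p q) has_field_derivative
      pd_x c x y * p ^ 3 - pd_x g x y * p\<^sup>2 + pd_x h x y * p - pd_x d x y) (at x)"
    "((\<lambda>t. cubic_ode2 c g h d x t p q) has_field_derivative
      pd_y c x y * p ^ 3 - pd_y g x y * p\<^sup>2 + pd_y h x y * p - pd_y d x y) (at y)"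
    "((\<lambda>t. cubic_ode2 c g h d x y t q) has_field_derivative
      3 * c x y * p\<^sup>2 - 2 * g x y * p + h x y) (at p)"
    "((\<lambda>t. cubic_ode2 c g h d x y p t) has_field_derivative 1) (at q)"
    unfolding cubic_ode2_def by (auto intro!: derivative_eq_intros pd)
  from this[THEN DERIV_imp_deriv] show ?thesis
    by (simp add: total_deriv2_def)
qed

theorem theorem1:
  fixes D :: "(real \<times> real) set"
    and \<alpha> \<beta> \<gamma> \<delta> \<epsilon> \<phi> c g h d :: "real \<Rightarrow> real \<Rightarrow> real"
  assumes "open D"
    and "smooth2_on D \<alpha>" "smooth2_on D \<beta>" "smooth2_on D \<gamma>"
        "smooth2_on D \<delta>" "smooth2_on D \<epsilon>" "smooth2_on D \<phi>"
    and "\<forall>(x, y)\<in>D. \<alpha> x y \<ge> 0"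
    and "\<forall>(x, y)\<in>D. c x y = sqrt (\<alpha> x y) / sqrt 3"
    and "\<forall>(x, y)\<in>D. c x y \<noteq> 0"
    and "\<forall>(x, y)\<in>D. g x y = (\<beta> x y - pd_y c x y) / (5 * c x y)"
    and "\<forall>(x, y)\<in>D. h x y = (\<gamma> x y - 2 * (g x y)^2 - pd_y g x y + pd_x c x y) / (4 * c x y)"
    and "\<forall>(x, y)\<in>D. d x y = (\<delta> x y - 3 * g x y * h x y - pd_y h x y + pd_x g x y) / (3 * c x y)"
    and "\<forall>(x, y)\<in>D. \<epsilon> x y = 2 * d x y * g x y + (h x y)^2 + pd_y d x y - pd_x h x y"
    and "\<forall>(x, y)\<in>D. \<phi> x y = d x y * h x y - pd_x d x y"
    and "\<exists>a b e f :: real \<Rightarrow> real \<Rightarrow> real.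
           smooth2_on D a \<and> smooth2_on D b \<and> smooth2_on D e \<and> smooth2_on D f \<and>
           (\<forall>(x, y)\<in>D.
              h x y = a x y - 2 * e x y \<and>
              g x y = f x y - 2 * b x y \<and>
              3 * pd_x b x y + 2 * pd_x g x y + pd_y h x y
                + 3 * b x y * e x y - 3 * c x y * d x y = 0 \<and>
              pd_y b x y - pd_x c x y + (b x y)^2 + b x y * g x y
                + c x y * h x y + c x y * e x y = 0 \<and>
              pd_y d x y - pd_x e x y - b x y * d x y - d x y * g x y
                - (e x y)^2 - e x y * h x y = 0 \<and>
              3 * pd_y e x y + 2 * pd_y h x y + pd_x g x y
                + 3 * b x y * e x y - 3 * c x y * d x y = 0)"
  shows "linearizable_via D (quintic_ode3 \<alpha> \<beta> \<gamma> \<delta> \<epsilon> \<phi>) c g h d"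
proof -
  note D = assms(1)
  \<comment> \<open>Since \<open>c\<close> does not vanish, neither does its square root
    \<open>sqrt (\<alpha> x y)\<close>; this excludes the points where the root is not
    smooth.\<close>
  have \<alpha>_pos: "\<forall>(x, y)\<in>D. \<alpha> x y > 0"
    using assms(8-10) by (fastforce simp: order_less_le)
  have "smooth2_on D (\<lambda>x y. sqrt (\<alpha> x y) / sqrt 3)"
    by (intro smooth2_on_divide smooth2_on_sqrt smooth2_on_const D assms(2) \<alpha>_pos) auto
  then have c: "smooth2_on D c"
    using smooth2_on_cong[OF D assms(9)] by blast
  note smooth_intros = smooth2_on_divide smooth2_on_add smooth2_on_diff smooth2_on_mult smooth2_on_const
    smooth2_on_pd_x smooth2_on_pd_y D
  have c0: "\<forall>(x, y)\<in>D. k * c x y \<noteq> 0" if "k \<noteq> 0" for k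
    using assms(10) that by auto
  \<comment> \<open>Smoothness is inherited in the order \<open>c\<close>, \<open>g\<close>,
    \<open>h\<close>, \<open>d\<close>, each formula using derivatives of the functions before
    it.\<close>
  have "smooth2_on D (\<lambda>x y. (\<beta> x y - pd_y c x y) / (5 * c x y))"
    by (intro smooth_intros assms c c0) simp
  then have g: "smooth2_on D g"
    using smooth2_on_cong[OF D assms(11)] by blast
  have "smooth2_on D (\<lambda>x y. (\<gamma> x y - 2 * (g x y)^2 - pd_y g x y + pd_x c x y) / (4 * c x y))"
    unfolding power2_eq_square by (intro smooth_intros assms c c0 g) simp
  then have h: "smooth2_on D h"
    using smooth2_on_cong[OF D assms(12)] by blast
  have "smooth2_on D (\<lambda>x y. (\<delta> x y - 3 * g x y * h x y - pd_y h x y + pd_x g x y) / (3 * c x y))"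
    by (intro smooth_intros assms c c0 g h) simp
  then have d: "smooth2_on D d"
    using smooth2_on_cong[OF D assms(13)] by blast

  have "quintic_ode3 \<alpha> \<beta> \<gamma> \<delta> \<epsilon> \<phi> x y p r = total_deriv2 (cubic_ode2 c g h d) x y p q r"
    if xy: "(x, y) \<in> D" and ode: "cubic_ode2 c g h d x y p q = 0" for x y p q r
  proof -
    have c0: "c x y \<noteq> 0" using bspec[OF assms(10) xy] by simp
    have q: "q = - c x y * p ^ 3 + g x y * p\<^sup>2 - h x y * p + d x y"
      using ode by (simp add: cubic_ode2_def)
    have "3 * (c x y)\<^sup>2 = \<alpha> x y"
      using bspec[OF assms(8) xy] bspec[OF assms(9) xy] by (simp add: power_divide)
    then have \<alpha>: "\<alpha> x y = 3 * (c x y)\<^sup>2" by simp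
    \<comment> \<open>After elimination of \<open>q\<close> the total derivative is a quintic in
      \<open>p\<close>. The formulas for \<open>c\<close>, \<open>g\<close>, \<open>h\<close>,
      \<open>d\<close> are its coefficients of degrees 5 to 2, solved one after the other; the
      consistency conditions are those of degrees 1 and 0.\<close>
    have \<beta>: "\<beta> x y = 5 * c x y * g x y + pd_y c x y"
      and \<gamma>: "\<gamma> x y = 4 * c x y * h x y + 2 * (g x y)\<^sup>2 + pd_y g x y - pd_x c x y"
      and \<delta>: "\<delta> x y = 3 * c x y * d x y + 3 * g x y * h x y + pd_y h x y - pd_x g x y"
      using bspec[OF assms(11) xy] bspec[OF assms(12) xy] bspec[OF assms(13) xy] c0 by (simp_all add: field_simps)
    have \<epsilon>: "\<epsilon> x y = 2 * d x y * g x y + (h x y)\<^sup>2 + pd_y d x y - pd_x h x y"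
      and \<phi>: "\<phi> x y = d x y * h x y - pd_x d x y"
      using bspec[OF assms(14) xy] bspec[OF assms(15) xy] by simp_all
    show ?thesis
      unfolding total_deriv2_cubic_ode2[OF c g h d xy] quintic_ode3_def \<alpha> \<beta> \<gamma> \<delta> \<epsilon> \<phi> q
      by (simp add: algebra_simps power2_eq_square power3_eq_cube eval_nat_numeral)
  qed
  then have derived: "obtained_by_differentiating D (quintic_ode3 \<alpha> \<beta> \<gamma> \<delta> \<epsilon> \<phi>) (cubic_ode2 c g h d)"
    by (auto simp: obtained_by_differentiating_def)

  obtain a b e f where abef: "smooth2_on D a" "smooth2_on D b" "smooth2_on D e" "smooth2_on D f"
    and coeffs: "\<And>x y. (x, y) \<in> D \<Longrightarrow> h x y = a x y - 2 * e x y"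
      "\<And>x y. (x, y) \<in> D \<Longrightarrow> g x y = f x y - 2 * b x y"
    and criteria: "\<And>x y. (x, y) \<in> D \<Longrightarrow> 3 * pd_x b x y + 2 * pd_x g x y + pd_y h x y
        + 3 * b x y * e x y - 3 * c x y * d x y = 0"
      "\<And>x y. (x, y) \<in> D \<Longrightarrow> pd_y b x y - pd_x c x y + (b x y)^2 + b x y * g x y
        + c x y * h x y + c x y * e x y = 0"
      "\<And>x y. (x, y) \<in> D \<Longrightarrow> pd_y d x y - pd_x e x y - b x y * d x y - d x y * g x y
        - (e x y)^2 - e x y * h x y = 0"
      "\<And>x y. (x, y) \<in> D \<Longrightarrow> 3 * pd_y e x y + 2 * pd_y h x y + pd_x g x y
        + 3 * b x y * e x y - 3 * c x y * d x y = 0"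
    using assms(16) by blast
  have h_y: "pd_y h x y = pd_y a x y - 2 * pd_y e x y" and g_x: "pd_x g x y = pd_x f x y - 2 * pd_x b x y"
    if xy: "(x, y) \<in> D" for x y
  proof -
    have "pd_y h x y = pd_y (\<lambda>x y. a x y - 2 * e x y) x y" "pd_x g x y = pd_x (\<lambda>x y. f x y - 2 * b x y) x y"
      using coeffs by (auto intro!: pd_x_cong[OF D xy] pd_y_cong[OF D xy])
    moreover have "pd_y (\<lambda>x y. a x y - 2 * e x y) x y = pd_y a x y - 2 * pd_y e x y"
      unfolding pd_y_def[of "\<lambda>x y. a x y - 2 * e x y"]
      by (intro DERIV_imp_deriv DERIV_diff DERIV_cmult smooth2_on_has_pd_y[OF _ xy] abef)
    moreover have "pd_x (\<lambda>x y. f x y - 2 * b x y) x y = pd_x f x y - 2 * pd_x b x y"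
      unfolding pd_x_def[of "\<lambda>x y. f x y - 2 * b x y"]
      by (intro DERIV_imp_deriv DERIV_diff DERIV_cmult smooth2_on_has_pd_x[OF _ xy] abef)
    ultimately show "pd_y h x y = pd_y a x y - 2 * pd_y e x y" "pd_x g x y = pd_x f x y - 2 * pd_x b x y"
      by simp_all
  qed
  have "transformable_to_linear D (cubic_ode2 c g h d)"
  proof (rule flat_connection_transformable_to_linear[OF D abef(1,2) c d abef(3,4)])
    fix x y assume xy: "(x, y) \<in> D"
    show "h x y = a x y - 2 * e x y" "g x y = f x y - 2 * b x y"
      using coeffs[OF xy] .
    note eqs = criteria[OF xy] h_y[OF xy] g_x[OF xy]
    \<comment> \<open>Three times the first curvature expression is twice the last criterion minus
      the first; three times the second one is the last criterion minus twice the first.\<close>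
    show "pd_y a x y - pd_x b x y + b x y * e x y - c x y * d x y = 0"
      "pd_y e x y - pd_x f x y + c x y * d x y - b x y * e x y = 0"
      using eqs(1,4-6) by linarith+
    show "pd_y d x y - pd_x e x y + b x y * d x y + (e x y)\<^sup>2 - a x y * e x y - d x y * f x y = 0"
      "pd_y b x y - pd_x c x y + a x y * c x y + b x y * f x y - (b x y)\<^sup>2 - c x y * e x y = 0"
      using eqs(2,3) unfolding coeffs[OF xy] by (simp_all add: algebra_simps power2_eq_square)
  qed
  then show ?thesis
    unfolding linearizable_via_def using c g h d derived by blast
qed

end
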